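(* Let $n\ge 2$, $k\ge 1$, $N\geq 1$ be integers and let $h(t)=g(t^2)$, $t\in[-1,1]$, where $g:[0,1]\to(-\infty,\infty]$ is finite and continuous on $[0,1)$, continuous in the extended sense at $1$ (i.e. $\lim_{u\to1^-}g(u)=g(1)$), and $(k+1)$-times differentiable in $(0,1)$. Assume there exists a spherical $(k,k)$-design $C\subset\mathbb S^{n-1}$ of cardinality $N$. If $g^{(k+1)}(u)\ge0$ on $(0,1)$ and $g(1)$ is finite, then $$M_N^h\ \le\ M_N^h(k)\ \le\ M^h(C)\ \le\ N\sum_{i=0}^{k+1}\delta_i\,h(\beta_i),$$ where $\beta_0=-1$, $\beta_{k+1}=1$, $\beta_1<\dots<\beta_k$ are the zeros of the Gegenbauer polynomial $P_k^{(n+2)}$, and $\delta_i$ are the associated weights (defined in the context).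
   Context: $\mathbb S^{n-1}$ is the unit sphere in $\mathbb R^n$; a spherical code is a finite nonempty set $C=\{x_1,\dots,x_N\}\subset\mathbb S^{n-1}$, $|C|=N$. Gegenbauer polynomials: $d\mu_n(t)=\gamma_n(1-t^2)^{(n-3)/2}\,dt$ on $[-1,1]$, where $\gamma_n$ is such that $\mu_n$ is a probability measure; $P_\ell^{(n)}$, $\ell\ge0$, are the polynomials with $\deg P_\ell^{(n)}=\ell$, pairwise orthogonal with respect to $\mu_n$, normalized by $P_\ell^{(n)}(1)=1$. A spherical code $C=\{x_1,\dots,x_N\}$ is a spherical $(k,k)$-design if $\sum_{i,j=1}^N P_\ell^{(n)}(x_i\cdot x_j)=0$ for every even $\ell=2,4,\dots,2k$. Potentials: $U^h(x,C)=\sum_{i=1}^N h(x\cdot x_i)$ for $x\in\mathbb S^{n-1}$; $M^h(C)=\sup_{x\in\mathbb S^{n-1}}U^h(x,C)$; $M_N^h=\inf\{M^h(C): C\subset\mathbb S^{n-1},\ |C|=N\}$; $M_N^h(k)=\inf\{M^h(C): C\subset\mathbb S^{n-1}\text{ is a }(k,k)\text{-design},\ |C|=N\}$. The zeros $\beta_1<\dots<\beta_k$ of $P_k^{(n+2)}$ are real, simple and lie in $(-1,1)$. The weights are $\delta_i=\int_{-1}^1\widetilde L_i\,d\mu_n$, $i=0,\dots,k+1$, where $\widetilde L_i$ are the fundamental Lagrange polynomials (of degree $k+1$) for the nodes $\beta_0,\dots,\beta_{k+1}$, i.e. $\widetilde L_i(\beta_j)=1$ if $i=j$ and $0$ otherwise.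 *)

theory Defs
  imports "HOL-Analysis.Analysis" "HOL-Computational_Algebra.Polynomial"
begin

text \<open>For \<open>n = 2\<close> the weight is singular at \<open>t = -1\<close> and \<open>t = 1\<close>, where \<open>powr\<close> returns \<open>0\<close>;
  the two endpoints are a null set.\<close>

definition gegenbauer_const :: "nat \<Rightarrow> real" where
  "gegenbauer_const n =
     1 / (LINT t:{-1..1}|lborel. (1 - t\<^sup>2) powr ((real n - 3) / 2))"

definition gegenbauer_measure :: "nat \<Rightarrow> real measure" where
  "gegenbauer_measure n =
     density lborel
       (\<lambda>t. ennreal (gegenbauer_const n * (1 - t\<^sup>2) powr ((real n - 3) / 2) * indicator {-1..1} t))"

definition is_gegenbauer_family :: "nat \<Rightarrow> (nat \<Rightarrow> real poly) \<Rightarrow> bool" where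
  "is_gegenbauer_family n P \<longleftrightarrow>
     (\<forall>l. degree (P l) = l) \<and>
     (\<forall>l m. l \<noteq> m \<longrightarrow> (LINT t|gegenbauer_measure n. poly (P l) t * poly (P m) t) = 0) \<and>
     (\<forall>l. poly (P l) 1 = 1)"

text \<open>For \<open>n \<ge> 2\<close> exactly one family satisfies the three conditions.\<close>

definition gegenbauer :: "nat \<Rightarrow> nat \<Rightarrow> real poly" where
  "gegenbauer n = (THE P. is_gegenbauer_family n P)"

text \<open>\<open>gegenbauer_node n k i\<close> is \<open>\<beta>\<^sub>i\<close>: \<open>-1\<close>, then the \<open>k\<close> zeros of the polynomial of
  degree \<open>k\<close> for dimension \<open>n + 2\<close> in increasing order, then \<open>1\<close>.\<close>

definition gegenbauer_node :: "nat \<Rightarrow> nat \<Rightarrow> nat \<Rightarrow> real" where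
  "gegenbauer_node n k i =
     (if i = 0 then -1
      else if i = k + 1 then 1
      else sorted_list_of_set {t. poly (gegenbauer (n + 2) k) t = 0} ! (i - 1))"

definition lagrange_basis :: "(nat \<Rightarrow> real) \<Rightarrow> nat set \<Rightarrow> nat \<Rightarrow> real poly" where
  "lagrange_basis x I i =
     (\<Prod>j\<in>I - {i}. smult (1 / (x i - x j)) [:- x j, 1:])"

lemma poly_lagrange_basis:
  assumes "finite I" "inj_on x I" "i \<in> I" "j \<in> I"
  shows "poly (lagrange_basis x I i) (x j) = (if i = j then 1 else 0)"
proof (cases "i = j")
  case True
  have "poly (lagrange_basis x I i) (x i) = (\<Prod>j\<in>I - {i}. 1)"
    unfolding lagrange_basis_def poly_prod
    using assms(2,3)
    by (intro prod.cong) (auto simp: diff_divide_distrib [symmetric] dest: inj_onD)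
  with True show ?thesis by simp
next
  case False
  with assms have "\<exists>m\<in>I - {i}. poly (smult (1 / (x i - x m)) [:- x m, 1:]) (x j) = 0"
    by (intro bexI[of _ j]) auto
  with assms(1) have "poly (lagrange_basis x I i) (x j) = 0"
    unfolding lagrange_basis_def poly_prod by (auto intro: prod_zero)
  with False show ?thesis by simp
qed

definition gegenbauer_weight :: "nat \<Rightarrow> nat \<Rightarrow> nat \<Rightarrow> real" where
  "gegenbauer_weight n k i =
     (LINT t|gegenbauer_measure n. poly (lagrange_basis (gegenbauer_node n k) {0..k+1} i) t)"

definition spherical_code :: "(real^'n) set \<Rightarrow> bool" where
  "spherical_code C \<longleftrightarrow> finite C \<and> C \<noteq> {} \<and> C \<subseteq> sphere 0 1"

definition spherical_kk_design :: "nat \<Rightarrow> (real^'n) set \<Rightarrow> bool" where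
  "spherical_kk_design k C \<longleftrightarrow>
     spherical_code C \<and>
     (\<forall>l\<in>{2..2*k}. even l \<longrightarrow>
        (\<Sum>x\<in>C. \<Sum>y\<in>C. poly (gegenbauer CARD('n) l) (x \<bullet> y)) = 0)"

definition potential :: "(real \<Rightarrow> ereal) \<Rightarrow> (real^'n) set \<Rightarrow> real^'n \<Rightarrow> ereal" where
  "potential h C x = (\<Sum>y\<in>C. h (x \<bullet> y))"

definition max_potential :: "(real \<Rightarrow> ereal) \<Rightarrow> (real^'n) set \<Rightarrow> ereal" where
  "max_potential h C = (SUP x\<in>sphere 0 1. potential h C x)"

text \<open>The type argument of the two infima supplies the ambient space \<open>real^'n\<close>.\<close>

definition minmax_potential :: "'n::finite itself \<Rightarrow> (real \<Rightarrow> ereal) \<Rightarrow> nat \<Rightarrow> ereal" where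
  "minmax_potential _ h N =
     (INF C\<in>{C :: (real^'n) set. spherical_code C \<and> card C = N}. max_potential h C)"

definition minmax_potential_design ::
    "'n::finite itself \<Rightarrow> (real \<Rightarrow> ereal) \<Rightarrow> nat \<Rightarrow> nat \<Rightarrow> ereal" where
  "minmax_potential_design _ h N k =
     (INF C\<in>{C :: (real^'n) set. spherical_kk_design k C \<and> card C = N}. max_potential h C)"

text \<open>The points of \<open>S\<close> are assumed interior: \<open>deriv\<close> uses full neighbourhoods.\<close>

definition times_differentiable_on :: "nat \<Rightarrow> (real \<Rightarrow> real) \<Rightarrow> real set \<Rightarrow> bool" where
  "times_differentiable_on m f S \<longleftrightarrow>
     (\<forall>j<m. \<forall>u\<in>S. ((deriv ^^ j) f) differentiable (at u))"

end

theory Submission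
  imports Defs "HOL-Probability.Probability"
begin

text \<open>
  Write \<open>f u\<close> for the real value of \<open>g u\<close>, so that \<open>h t = f (t\<^sup>2)\<close>. The bound is the linear
  programming argument for designs, and it rests on three facts.

  \<^item> Majorisation. Let \<open>Z\<close> be the set of the \<open>k\<close> zeros of the Gegenbauer polynomial for dimension
    \<open>n + 2\<close>; it is symmetric about \<open>0\<close> and lies in \<open>(-1, 1)\<close>. In the variable \<open>u = t\<^sup>2\<close> interpolate
    \<open>f\<close> at \<open>1\<close> and at the squares of \<open>Z\<close>, matching also the derivative at each square other than
    \<open>0\<close>. By the symmetry of \<open>Z\<close> these are exactly \<open>k + 1\<close> conditions, so there is an interpolant \<open>p\<close>
    of degree at most \<open>k\<close>. At each point the error \<open>f - p\<close> is a value of the derivative of order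
    \<open>k + 1\<close>, divided by \<open>(k + 1)!\<close>, times the nodal polynomial. The former is nonnegative and the
    latter nonpositive on \<open>[0, 1]\<close>: the factor \<open>u - 1\<close> is at most \<open>0\<close>, a possible node \<open>0\<close>
    contributes \<open>u \<ge> 0\<close>, all other nodes occur squared. Hence
    \<open>f \<le> p\<close> on \<open>[0, 1]\<close>, with equality at the nodes (\<open>hermite_majorant\<close>).

  \<^item> Averaging. The even polynomial \<open>q t = p (t\<^sup>2)\<close> has degree at most \<open>2 k\<close>, and for a
    \<open>(k, k)\<close>-design the sum of \<open>q (x \<bullet> y)\<close> over \<open>y\<close> in \<open>C\<close> is \<open>N\<close> times the integral of \<open>q\<close>, for
    every unit vector \<open>x\<close> (\<open>design_average\<close>). The definition of a design only controls the double
    sums over \<open>C\<close>. To pass to a single sum, compare the symmetric tensors \<open>y \<otimes> \<dots> \<otimes> y\<close> of order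
    \<open>2 m\<close>, summed over \<open>C\<close>, with a multiple of the moment tensor of a standard Gaussian vector:
    the double sums say that the squared norm of the difference is \<open>0\<close>, so the tensors agree
    (\<open>unit_vectors_moment_pointwise\<close>).

  \<^item> Quadrature. Since \<open>(1 - t\<^sup>2) d\<mu>\<^sub>n\<close> is proportional to \<open>d\<mu>\<^sub>n\<^sub>+\<^sub>2\<close>, the nodal polynomial of the
    points \<open>-1\<close>, \<open>Z\<close>, \<open>1\<close> is orthogonal under \<open>\<mu>\<^sub>n\<close> to all polynomials of degree below \<open>k\<close>.
    The interpolatory rule at these points is therefore exact up to degree \<open>2 k + 1\<close>
    (\<open>gegenbauer_lobatto_quadrature\<close>), and the integral of \<open>q\<close> is the weighted sum of the values
    \<open>q (\<beta>\<^sub>i) = h (\<beta>\<^sub>i)\<close>.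

  All inner products lie in \<open>[-1, 1]\<close>, so the three facts chain to the stated bound at each \<open>x\<close>.
\<close>

section \<open>Orthogonal polynomials for an even positive functional\<close>

text \<open>
  The theory of orthogonal polynomials uses integration only through these four properties, so it
  is developed for an abstract functional and carries over at once to \<open>\<mu>\<^sub>n\<close> and to \<open>\<mu>\<^sub>n\<^sub>+\<^sub>2\<close>.
\<close>

locale even_positive_functional =
  fixes J :: "real poly \<Rightarrow> real"
  assumes add: "J (p + q) = J p + J q"
    and smult: "J (smult c p) = c * J p"
    and pos: "p \<noteq> 0 \<Longrightarrow> (\<And>t. -1 < t \<Longrightarrow> t < 1 \<Longrightarrow> poly p t \<ge> 0) \<Longrightarrow> J p > 0"
    and reflect: "J (pcompose p [:0, -1:]) = J p"
begin

lemma zero [simp]: "J 0 = 0"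
  using smult[of 0 0] by simp

lemma minus: "J (- p) = - J p"
  using smult[of "-1" p] by simp

lemma diff: "J (p - q) = J p - J q"
  using add[of p "- q"] minus[of q] by simp

lemma sum: "J (\<Sum>i\<in>A. f i) = (\<Sum>i\<in>A. J (f i))"
  by (induction A rule: infinite_finite_induct) (auto simp: add)

lemma square_pos: "p \<noteq> 0 \<Longrightarrow> J (p * p) > 0"
  by (rule pos) auto

end

text \<open>
  Polynomials with one member in each degree below \<open>l\<close> span all polynomials of degree below \<open>l\<close>:
  subtracting a multiple of \<open>Q l\<close> kills the leading coefficient. Here and below, degree less than
  \<open>l\<close> is expressed by vanishing coefficients from \<open>l\<close> on, which for \<open>l = 0\<close> means the zero
  polynomial.
\<close>

lemma vanishes_on_graded_span:
  fixes K :: "real poly \<Rightarrow> real" and Q :: "nat \<Rightarrow> real poly"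
  assumes add: "\<And>p q. K (p + q) = K p + K q" and smult: "\<And>c p. K (smult c p) = c * K p"
    and deg: "\<And>j. j < l \<Longrightarrow> degree (Q j) = j \<and> Q j \<noteq> 0"
    and vanish: "\<And>j. j < l \<Longrightarrow> K (Q j) = 0"
    and r: "\<And>i. i \<ge> l \<Longrightarrow> coeff r i = 0"
  shows "K r = 0"
  using deg vanish r
proof (induction l arbitrary: r)
  case 0
  then have "r = 0" by (simp add: poly_eq_iff)
  then show ?case using smult[of 0 0] by simp
next
  case (Suc l)
  define c where "c = coeff r l / lead_coeff (Q l)"
  have Q: "degree (Q l) = l" "coeff (Q l) l \<noteq> 0" "K (Q l) = 0"
    using Suc.prems(1)[of l] Suc.prems(2)[of l] leading_coeff_0_iff[of "Q l"] by auto
  have "K (r + smult (- c) (Q l)) = 0"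
  proof (rule Suc.IH)
    fix i assume i: "i \<ge> l"
    show "coeff (r + smult (- c) (Q l)) i = 0"
    proof (cases "i = l")
      case True
      then show ?thesis using Q by (simp add: c_def)
    next
      case False
      then show ?thesis using i Q Suc.prems(3)[of i] by (simp add: coeff_eq_0)
    qed
  qed (use Suc.prems in auto)
  moreover have "K (r + smult (- c) (Q l)) = K r + - c * K (Q l)" by (simp only: add smult)
  ultimately show ?case using Q(3) by simp
qed

definition is_orthogonal_of_degree :: "(real poly \<Rightarrow> real) \<Rightarrow> nat \<Rightarrow> real poly \<Rightarrow> bool" where
  "is_orthogonal_of_degree J l Q \<longleftrightarrow>
     degree Q = l \<and> Q \<noteq> 0 \<and> (\<forall>r. (\<forall>i\<ge>l. coeff r i = 0) \<longrightarrow> J (Q * r) = 0)"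

context even_positive_functional
begin

text \<open>
  Gram--Schmidt applied to the monomial of degree \<open>l\<close>.
\<close>

lemma ex_orthogonal_of_degree: "\<exists>Q. is_orthogonal_of_degree J l Q"
proof (induction l rule: less_induct)
  case (less l)
  then obtain Q where Q: "\<And>j. j < l \<Longrightarrow> is_orthogonal_of_degree J j (Q j)"
    by metis
  have orth: "J (Q i * Q j) = 0" if "i < l" "j < l" "i \<noteq> j" for i j
  proof -
    have *: "J (Q i * Q j) = 0" if "j < i" "i < l" for i j
      using Q[of i] Q[of j] that unfolding is_orthogonal_of_degree_def
      by (auto simp: coeff_eq_0)
    show ?thesis using *[of i j] *[of j i] that by (cases i j rule: linorder_cases) (auto simp: mult.commute)
  qed
  define S where "S = (\<Sum>j<l. smult (J (monom 1 l * Q j) / J (Q j * Q j)) (Q j))"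
  define R where "R = monom 1 l - S"
  have cS: "coeff S i = 0" if "i \<ge> l" for i
    unfolding S_def coeff_sum using Q that
    by (intro sum.neutral) (auto simp: is_orthogonal_of_degree_def coeff_eq_0)
  have cR: "coeff R l = 1" "\<And>i. i > l \<Longrightarrow> coeff R i = 0"
    using cS by (auto simp: R_def)
  have degR: "degree R = l"
    using cR by (intro antisym degree_le le_degree) auto
  have RQ: "J (R * Q j) = 0" if j: "j < l" for j
  proof -
    have "J (S * Q j) = (\<Sum>i<l. J (monom 1 l * Q i) / J (Q i * Q i) * J (Q i * Q j))"
      by (simp add: S_def sum_distrib_right sum smult)
    also have "\<dots> = (\<Sum>i<l. if i = j then J (monom 1 l * Q j) else 0)"
      using orth j square_pos[of "Q j"] Q[of j]
      by (intro sum.cong) (auto simp: is_orthogonal_of_degree_def)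
    also have "\<dots> = J (monom 1 l * Q j)" using j by simp
    finally show ?thesis by (simp add: R_def left_diff_distrib diff)
  qed
  have "J (R * r) = 0" if "\<forall>i\<ge>l. coeff r i = 0" for r
    by (rule vanishes_on_graded_span[where K = "\<lambda>r. J (R * r)" and Q = Q and l = l])
       (use Q RQ that in \<open>auto simp: distrib_left add smult is_orthogonal_of_degree_def\<close>)
  then show ?case using degR cR unfolding is_orthogonal_of_degree_def by (intro exI[of _ R]) auto
qed

end

text \<open>
  Multiplying \<open>p\<close> by one linear factor for each of its zeros of odd order in \<open>(-1, 1)\<close> removes
  all sign changes there. Multiplicities are avoided by splitting off one zero at a time, which
  toggles its membership in \<open>S\<close>.
\<close>

lemma sign_change_polynomial:
  fixes p :: "real poly"
  assumes "p \<noteq> 0"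
  shows "\<exists>S c. finite S \<and> S \<subseteq> {t. -1 < t \<and> t < 1 \<and> poly p t = 0} \<and> c \<noteq> 0 \<and>
           (\<forall>t. -1 < t \<and> t < 1 \<longrightarrow> c * poly p t * (\<Prod>s\<in>S. t - s) \<ge> 0)"
  using assms
proof (induction "degree p" arbitrary: p rule: less_induct)
  case less
  show ?case
  proof (cases "\<exists>s. -1 < s \<and> s < 1 \<and> poly p s = 0")
    case False
    have "poly p 0 * poly p t \<ge> 0" if t: "-1 < t" "t < 1" for t
    proof (rule ccontr)
      assume neg: "\<not> poly p 0 * poly p t \<ge> 0"
      then have "t \<noteq> 0" by auto
      then consider "0 < t" | "t < 0" by linarith
      then show False
      proof cases
        case 1
        then obtain x where "0 < x" "x < t" "poly p x = 0"
          using poly_IVT[of 0 t p] neg by auto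
        then show False using False t by auto
      next
        case 2
        then obtain x where "t < x" "x < 0" "poly p x = 0"
          using poly_IVT[of t 0 p] neg by (auto simp: mult.commute)
        then show False using False t by auto
      qed
    qed
    moreover have "poly p 0 \<noteq> 0" using False by auto
    ultimately show ?thesis by (intro exI[of _ "{}"] exI[of _ "poly p 0"]) auto
  next
    case True
    then obtain s where s: "-1 < s" "s < 1" "poly p s = 0" by blast
    then obtain p' where p': "p = [:-s, 1:] * p'" by (auto simp: poly_eq_0_iff_dvd dvd_def)
    with less.prems have "p' \<noteq> 0" by auto
    then have "degree p' < degree p" unfolding p' by (subst degree_mult_eq) auto
    from less.hyps[OF this \<open>p' \<noteq> 0\<close>] obtain S c where S: "finite S" "c \<noteq> 0"
      "S \<subseteq> {t. -1 < t \<and> t < 1 \<and> poly p' t = 0}"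
      "\<And>t. -1 < t \<Longrightarrow> t < 1 \<Longrightarrow> c * poly p' t * (\<Prod>s\<in>S. t - s) \<ge> 0" by blast
    show ?thesis
    proof (cases "s \<in> S")
      case True
      then have eq: "c * poly p t * (\<Prod>s\<in>S - {s}. t - s) = c * poly p' t * (\<Prod>s\<in>S. t - s)" for t
        using S(1) by (simp add: p' prod.remove[of S s] algebra_simps)
      show ?thesis
        using S unfolding eq[symmetric] by (intro exI[of _ "S - {s}"] exI[of _ c]) (auto simp: p')
    next
      case False
      then have eq: "c * poly p t * (\<Prod>s\<in>insert s S. t - s)
                  = c * poly p' t * (\<Prod>s\<in>S. t - s) * (t - s)\<^sup>2" for t
        using S(1) by (simp add: p' power2_eq_square algebra_simps)
      have "\<forall>t. -1 < t \<and> t < 1 \<longrightarrow> c * poly p t * (\<Prod>s\<in>insert s S. t - s) \<ge> 0"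
        unfolding eq using S(4) by simp
      moreover have "insert s S \<subseteq> {t. -1 < t \<and> t < 1 \<and> poly p t = 0}"
        using S(3) s by (auto simp: p')
      ultimately show ?thesis using S(1,2) by (intro exI[of _ "insert s S"] exI[of _ c]) simp
    qed
  qed
qed

lemma poly_prod_linear: "poly (\<Prod>s\<in>S. [:- s, 1:]) t = (\<Prod>s\<in>S. t - s :: real)"
  by (simp add: poly_prod)

lemma degree_prod_linear: "finite S \<Longrightarrow> degree (\<Prod>s\<in>S. [:- f s, 1:] :: real poly) = card S"
  by (subst degree_prod_eq_sum_degree) auto

context even_positive_functional
begin

text \<open>
  If \<open>Q\<close> changed sign at fewer than \<open>l\<close> points of \<open>(-1, 1)\<close>, its product with the sign change
  polynomial would have constant sign and hence nonzero integral, although orthogonality makes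
  that integral zero. So there are \<open>l\<close> sign changes, which exhausts the degree.
\<close>

lemma orthogonal_zeros:
  assumes "is_orthogonal_of_degree J l Q"
  shows "finite {t. poly Q t = 0}" "card {t. poly Q t = 0} = l"
    "{t. poly Q t = 0} \<subseteq> {-1<..<1}"
proof -
  have Q: "degree Q = l" "Q \<noteq> 0" "\<And>r. (\<forall>i\<ge>l. coeff r i = 0) \<Longrightarrow> J (Q * r) = 0"
    using assms unfolding is_orthogonal_of_degree_def by auto
  show fin: "finite {t. poly Q t = 0}" using Q by (simp add: poly_roots_finite)
  have le: "card {t. poly Q t = 0} \<le> l" using card_poly_roots_bound[of Q] Q by simp
  obtain S c where S: "finite S" "c \<noteq> 0" "S \<subseteq> {t. -1 < t \<and> t < 1 \<and> poly Q t = 0}"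
      "\<And>t. -1 < t \<Longrightarrow> t < 1 \<Longrightarrow> c * poly Q t * (\<Prod>s\<in>S. t - s) \<ge> 0"
    using sign_change_polynomial[OF Q(2)] by blast
  define r where "r = smult c (\<Prod>s\<in>S. [:- s, 1:])"
  have "J (Q * r) > 0"
  proof (rule pos)
    show "Q * r \<noteq> 0" using Q S by (auto simp: r_def)
    show "poly (Q * r) t \<ge> 0" if "-1 < t" "t < 1" for t
      using S(4)[OF that] by (simp add: r_def poly_prod_linear mult_ac)
  qed
  moreover have "degree r = card S" using S by (simp add: r_def degree_prod_linear)
  ultimately have "l \<le> card S" using Q(3)[of r] by (metis coeff_eq_0 less_irrefl not_le order_less_le_trans)
  moreover have sub: "S \<subseteq> {t. poly Q t = 0}" using S by auto
  ultimately have "S = {t. poly Q t = 0}"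
    using le fin by (intro card_seteq) auto
  then show "card {t. poly Q t = 0} = l" "{t. poly Q t = 0} \<subseteq> {-1<..<1}"
    using S le \<open>l \<le> card S\<close> by auto
qed

text \<open>
  After scaling to equal leading coefficients the difference has degree below \<open>l\<close>, so it is
  orthogonal to itself. The value at \<open>1\<close> fixes the scale because all zeros are smaller than \<open>1\<close>.
\<close>

lemma orthogonal_unique:
  assumes P: "is_orthogonal_of_degree J l P" and Q: "is_orthogonal_of_degree J l Q"
    and eq: "poly P 1 = poly Q 1"
  shows "P = Q"
proof -
  define c where "c = lead_coeff P / lead_coeff Q"
  have d: "degree P = l" "degree Q = l" "P \<noteq> 0" "Q \<noteq> 0" "coeff Q l \<noteq> 0"
    and orth: "\<And>r. (\<forall>i\<ge>l. coeff r i = 0) \<Longrightarrow> J (P * r) = 0 \<and> J (Q * r) = 0"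
    using P Q unfolding is_orthogonal_of_degree_def by (metis leading_coeff_0_iff)+
  define r where "r = P - smult c Q"
  have cr: "\<forall>i\<ge>l. coeff r i = 0"
  proof (intro allI impI)
    fix i assume "l \<le> i"
    then show "coeff r i = 0" using d by (cases "i = l") (auto simp: r_def c_def coeff_eq_0)
  qed
  have "J (r * r) = J (P * r) - c * J (Q * r)"
    by (simp add: r_def left_diff_distrib diff smult right_diff_distrib)
  then have "J (r * r) = 0" using orth[OF cr] by simp
  then have "r = 0" using square_pos[of r] by auto
  then have PQ: "P = smult c Q" by (simp add: r_def)
  moreover have "poly Q 1 \<noteq> 0" using orthogonal_zeros(3)[OF Q] by auto
  ultimately have "c = 1" using eq by simp
  with PQ show ?thesis by simp
qed

text \<open>
  The functional is invariant under reflection, so the reflected polynomial is orthogonal as well,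
  and the difference below has degree less than \<open>l\<close> and is orthogonal to itself.
\<close>

lemma orthogonal_parity:
  assumes Q: "is_orthogonal_of_degree J l Q"
  shows "pcompose Q [:0, -1:] = smult ((-1) ^ l) Q"
proof -
  have d: "degree Q = l" "Q \<noteq> 0" and orth: "\<And>r. (\<forall>i\<ge>l. coeff r i = 0) \<Longrightarrow> J (Q * r) = 0"
    using Q unfolding is_orthogonal_of_degree_def by auto
  have cc: "coeff (pcompose p [:0, -1:]) i = (-1) ^ i * coeff p i" for p :: "real poly" and i
    using coeff_pcompose_linear[of p "-1" i] by simp
  define r where "r = pcompose Q [:0, -1:] - smult ((-1) ^ l) Q"
  have cr: "\<forall>i\<ge>l. coeff r i = 0"
  proof (intro allI impI)
    fix i assume "l \<le> i"
    then show "coeff r i = 0" using d by (cases "i = l") (auto simp: r_def cc coeff_eq_0)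
  qed
  have inv: "pcompose (pcompose p [:0, -1:]) [:0, -1:] = p" for p :: "real poly"
    by (simp add: poly_eq_iff cc flip: mult.assoc power_mult_distrib)
  have "J (pcompose Q [:0, -1:] * r) = J (pcompose (Q * pcompose r [:0, -1:]) [:0, -1:])"
    by (simp add: pcompose_mult inv)
  also have "\<dots> = 0" unfolding reflect by (rule orth) (use cr in \<open>simp add: cc\<close>)
  finally have "J (r * r) = 0"
    using orth[OF cr] by (simp add: r_def left_diff_distrib diff smult)
  then have "r = 0" using square_pos[of r] by auto
  then show ?thesis by (simp add: r_def)
qed

end

section \<open>The Gegenbauer measure and its moments\<close>

lemma one_minus_square_pos: "-1 < t \<Longrightarrow> t < 1 \<Longrightarrow> 0 < 1 - (t::real)\<^sup>2"
  by (simp add: abs_square_less_1 abs_less_iff)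

definition gegenbauer_density :: "nat \<Rightarrow> real \<Rightarrow> real" where
  "gegenbauer_density n t = (1 - t\<^sup>2) powr ((real n - 3) / 2) * indicator {-1..1} t"

lemma gegenbauer_density_measurable [measurable]: "gegenbauer_density n \<in> borel_measurable borel"
  unfolding gegenbauer_density_def by measurable

lemma gegenbauer_density_nonneg: "gegenbauer_density n t \<ge> 0"
  unfolding gegenbauer_density_def by simp

lemma gegenbauer_density_pos: "-1 < t \<Longrightarrow> t < 1 \<Longrightarrow> gegenbauer_density n t > 0"
  using one_minus_square_pos[of t] by (simp add: gegenbauer_density_def)

lemma gegenbauer_density_eq_0: "\<not> (-1 < t \<and> t < 1) \<Longrightarrow> gegenbauer_density n t = 0"
  by (cases "t = 1 \<or> t = -1") (auto simp: gegenbauer_density_def indicator_def)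

text \<open>
  This is the density for \<open>n = 2\<close>, the most singular case; it dominates the densities for all
  larger \<open>n\<close>.
\<close>

lemma integrable_arcsin_density:
  "integrable lborel (\<lambda>t::real. indicator {-1..1} t * inverse (sqrt (1 - t\<^sup>2)))"
proof -
  have "((\<lambda>t. inverse (sqrt (1 - t\<^sup>2))) has_integral (arcsin 1 - arcsin (-1))) {-1..1}"
    by (rule fundamental_theorem_of_calculus_interior)
       (auto intro!: continuous_on_arcsin' continuous_intros DERIV_arcsin
          simp flip: has_real_derivative_iff_has_vector_derivative)
  then have "(\<lambda>t::real. inverse (sqrt (1 - t\<^sup>2))) absolutely_integrable_on {-1..1}"
    by (intro nonnegative_absolutely_integrable_1)
       (auto simp: abs_square_le_1 abs_le_iff has_integral_integrable)
  then show ?thesis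
    unfolding set_integrable_def by (subst (asm) integrable_completion) auto
qed

lemma integrable_gegenbauer_density:
  assumes "n \<ge> 2"
  shows "integrable lborel (gegenbauer_density n)"
proof (rule Bochner_Integration.integrable_bound[OF integrable_arcsin_density])
  show "AE t in lborel. norm (gegenbauer_density n t)
          \<le> norm (indicator {-1..1} t * inverse (sqrt (1 - t\<^sup>2)))"
  proof (rule AE_I2)
    fix t :: real
    show "norm (gegenbauer_density n t) \<le> norm (indicator {-1..1} t * inverse (sqrt (1 - t\<^sup>2)))"
    proof (cases "-1 < t \<and> t < 1")
      case True
      then have t: "0 < 1 - t\<^sup>2" "1 - t\<^sup>2 \<le> 1"
        by (auto simp: abs_square_less_1 abs_less_iff)
      have "(1 - t\<^sup>2) powr ((real n - 3) / 2) \<le> (1 - t\<^sup>2) powr (- (1 / 2))"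
        using t assms by (intro powr_mono') auto
      also have "\<dots> = inverse (sqrt (1 - t\<^sup>2))"
        using t by (simp add: powr_minus powr_half_sqrt)
      finally show ?thesis using True t by (simp add: gegenbauer_density_def)
    qed (simp add: gegenbauer_density_eq_0)
  qed
qed simp

lemma borel_measurable_poly [measurable]: "poly p \<in> borel_measurable (borel :: real measure)"
  by (intro borel_measurable_continuous_onI continuous_intros)

lemma integrable_density_poly:
  assumes "n \<ge> 2"
  shows "integrable lborel (\<lambda>t. gegenbauer_density n t * poly p t)"
proof -
  have "bounded (poly p ` {-1..1})"
    by (intro compact_imp_bounded compact_continuous_image) (auto intro: continuous_intros)
  then obtain B where B: "\<And>t. t \<in> {-1..1} \<Longrightarrow> \<bar>poly p t\<bar> \<le> B"
    unfolding bounded_iff by (metis imageI real_norm_def)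
  have "integrable lborel (\<lambda>t. B * gegenbauer_density n t)"
    using integrable_gegenbauer_density[OF assms] by simp
  then show ?thesis
  proof (rule Bochner_Integration.integrable_bound)
    show "AE t in lborel. norm (gegenbauer_density n t * poly p t) \<le> norm (B * gegenbauer_density n t)"
    proof (rule AE_I2)
      fix t :: real
      show "norm (gegenbauer_density n t * poly p t) \<le> norm (B * gegenbauer_density n t)"
      proof (cases "-1 < t \<and> t < 1")
        case True
        then have "\<bar>poly p t\<bar> \<le> \<bar>B\<bar>" using B[of t] by auto
        then show ?thesis
          unfolding real_norm_def abs_mult by (subst mult.commute) (rule mult_right_mono, auto)
      qed (simp add: gegenbauer_density_eq_0)
    qed
  qed simp
qed

lemma density_poly_pos:
  assumes n: "n \<ge> 2" and p: "p \<noteq> 0" and nonneg: "\<And>t. -1 < t \<Longrightarrow> t < 1 \<Longrightarrow> poly p t \<ge> 0"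
  shows "(LINT t|lborel. gegenbauer_density n t * poly p t) > 0"
proof -
  let ?f = "\<lambda>t. gegenbauer_density n t * poly p t"
  have f: "?f t \<ge> 0" for t
    using nonneg[of t] gegenbauer_density_nonneg[of n t] gegenbauer_density_eq_0[of t n] by fastforce
  have "(LINT t|lborel. ?f t) \<noteq> 0"
  proof
    assume "(LINT t|lborel. ?f t) = 0"
    then have "AE t in lborel. ?f t = 0"
      using integral_nonneg_eq_0_iff_AE[OF integrable_density_poly[OF n]] f by auto
    \<comment> \<open>On the open interval the density is positive, so almost every point of it would have to be
      one of the finitely many zeros of \<open>p\<close>.\<close>
    moreover have "AE t in lborel. t \<notin> {t. poly p t = 0}"
      by (intro AE_not_in finite_imp_null_set_lborel poly_roots_finite p)
    ultimately have "AE t::real in lborel. t \<notin> {-1<..<1}"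
    proof eventually_elim
      case (elim t)
      then show ?case using gegenbauer_density_pos[of t n] by auto
    qed
    then have "emeasure lborel {t::real. -1 < t \<and> t < 1} = 0"
      by (subst (asm) AE_iff_measurable[OF _ refl]) auto
    moreover have "{t::real. -1 < t \<and> t < 1} = {-1<..<1}" by auto
    ultimately have "emeasure lborel {-1<..<1::real} = 0" by simp
    then show False by simp
  qed
  moreover have "(LINT t|lborel. ?f t) \<ge> 0" by (rule Bochner_Integration.integral_nonneg) (rule f)
  ultimately show ?thesis by linarith
qed

definition gegenbauer_functional :: "nat \<Rightarrow> real poly \<Rightarrow> real" where
  "gegenbauer_functional n p = (LINT t|gegenbauer_measure n. poly p t)"

lemma gegenbauer_const_eq: "gegenbauer_const n = 1 / (LINT t|lborel. gegenbauer_density n t)"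
  by (simp add: gegenbauer_const_def set_lebesgue_integral_def gegenbauer_density_def mult.commute)

lemma gegenbauer_total_mass_pos: "n \<ge> 2 \<Longrightarrow> (LINT t|lborel. gegenbauer_density n t) > 0"
  using density_poly_pos[of n 1] by simp

lemma gegenbauer_const_pos: "n \<ge> 2 \<Longrightarrow> gegenbauer_const n > 0"
  using gegenbauer_total_mass_pos[of n] by (simp add: gegenbauer_const_eq)

lemma gegenbauer_functional_eq:
  assumes "n \<ge> 2"
  shows "gegenbauer_functional n p =
    (LINT t|lborel. gegenbauer_density n t * poly p t) / (LINT t|lborel. gegenbauer_density n t)"
proof -
  have "gegenbauer_functional n p = (LINT t|lborel. (gegenbauer_const n * gegenbauer_density n t) *\<^sub>R poly p t)"
    unfolding gegenbauer_functional_def gegenbauer_measure_def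
    using gegenbauer_const_pos[OF assms]
    by (subst integral_density) (auto simp: gegenbauer_density_def mult.assoc)
  also have "\<dots> = gegenbauer_const n * (LINT t|lborel. gegenbauer_density n t * poly p t)"
    by (simp add: mult.assoc)
  finally show ?thesis by (simp add: gegenbauer_const_eq)
qed

lemma even_positive_functional_gegenbauer:
  assumes n: "n \<ge> 2"
  shows "even_positive_functional (gegenbauer_functional n)"
proof
  fix p q :: "real poly" and c :: real
  show "gegenbauer_functional n (p + q) = gegenbauer_functional n p + gegenbauer_functional n q"
    using integrable_density_poly[OF n]
    by (simp add: gegenbauer_functional_eq[OF n] distrib_left add_divide_distrib)
  show "gegenbauer_functional n (smult c p) = c * gegenbauer_functional n p"
    by (simp add: gegenbauer_functional_eq[OF n] mult.left_commute[of _ c])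
  show "gegenbauer_functional n p > 0" if "p \<noteq> 0" "\<And>t. -1 < t \<Longrightarrow> t < 1 \<Longrightarrow> poly p t \<ge> 0"
    using density_poly_pos[OF n that] gegenbauer_total_mass_pos[OF n]
    by (simp add: gegenbauer_functional_eq[OF n])
  have "(LINT t|lborel. gegenbauer_density n t * poly p t)
      = (LINT t|lborel. gegenbauer_density n (0 + (-1) * t) * poly p (0 + (-1) * t))"
    using lborel_integral_real_affine[of "-1" "\<lambda>t. gegenbauer_density n t * poly p t" 0] by simp
  moreover have "gegenbauer_density n (- t) = gegenbauer_density n t" for t
    by (auto simp: gegenbauer_density_def indicator_def)
  ultimately show "gegenbauer_functional n (pcompose p [:0, -1:]) = gegenbauer_functional n p"
    by (simp add: gegenbauer_functional_eq[OF n] poly_pcompose)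
qed

lemma gegenbauer_functional_1: "n \<ge> 2 \<Longrightarrow> gegenbauer_functional n 1 = 1"
  using gegenbauer_total_mass_pos[of n] by (simp add: gegenbauer_functional_eq)

text \<open>
  Multiplying the density for \<open>n\<close> by \<open>1 - t\<^sup>2\<close> gives the unnormalised density for \<open>n + 2\<close>. This
  is why zeros of the polynomials for dimension \<open>n + 2\<close> serve as quadrature nodes for \<open>\<mu>\<^sub>n\<close>.
\<close>

lemma gegenbauer_functional_shift:
  assumes n: "n \<ge> 2"
  shows "gegenbauer_functional n ([:1, 0, -1:] * p) =
           gegenbauer_functional n [:1, 0, -1:] * gegenbauer_functional (n + 2) p"
proof -
  have *: "gegenbauer_density n t * poly [:1, 0, -1:] t = gegenbauer_density (n + 2) t" for t
  proof (cases "-1 < t \<and> t < 1")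
    case True
    then have t: "0 < 1 - t\<^sup>2" by (auto simp: abs_square_less_1 abs_less_iff)
    have "(real (n + 2) - 3) / 2 = (real n - 3) / 2 + 1" by (simp add: field_simps)
    then have "(1 - t\<^sup>2) powr ((real (n + 2) - 3) / 2) = (1 - t\<^sup>2) powr ((real n - 3) / 2) * (1 - t\<^sup>2)"
      using t by (simp only: powr_add) simp
    then show ?thesis using True by (simp add: gegenbauer_density_def power2_eq_square)
  qed (simp add: gegenbauer_density_eq_0)
  have **: "gegenbauer_density n t * poly ([:1, 0, -1:] * p) t = gegenbauer_density (n + 2) t * poly p t" for t
    by (simp only: poly_mult *[symmetric] mult.assoc)
  have "n + 2 \<ge> 2" by simp
  from gegenbauer_total_mass_pos[OF this] gegenbauer_total_mass_pos[OF n]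
  show ?thesis
    unfolding gegenbauer_functional_eq[OF n] gegenbauer_functional_eq[OF \<open>n + 2 \<ge> 2\<close>] * **
    by simp
qed

text \<open>
  Integrate the derivative of \<open>t\<^bsup>2m+1\<^esup> (1 - t\<^sup>2)\<^bsup>(n-1)/2\<^esup>\<close>, a function that vanishes at both
  endpoints.
\<close>

lemma gegenbauer_moment_Suc:
  assumes n: "n \<ge> 2"
  shows "(real n + 2 * real m) * gegenbauer_functional n (monom 1 (2 * Suc m))
       = (2 * real m + 1) * gegenbauer_functional n (monom 1 (2 * m))"
proof -
  interpret even_positive_functional "gegenbauer_functional n"
    by (rule even_positive_functional_gegenbauer[OF n])
  define a where "a = (real n - 3) / 2"
  define p where "p = smult (2 * real m + 1) (monom 1 (2 * m)) - smult (real n + 2 * real m) (monom 1 (2 * Suc m))"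
  have "((\<lambda>t. (1 - t\<^sup>2) powr a * poly p t) has_integral
      (1 ^ (2 * m + 1) * (1 - 1\<^sup>2) powr (a + 1) - (-1) ^ (2 * m + 1) * (1 - (-1)\<^sup>2) powr (a + 1))) {-1..1::real}"
  proof (rule fundamental_theorem_of_calculus_interior)
    have "a + 1 > 0" using n by (simp add: a_def field_simps)
    then show "continuous_on {-1..1} (\<lambda>t::real. t ^ (2 * m + 1) * (1 - t\<^sup>2) powr (a + 1))"
      by (intro continuous_intros continuous_on_powr') (auto simp: abs_square_le_1 abs_le_iff)
    fix t :: real assume "t \<in> {-1<..<1}"
    then have t: "0 < 1 - t\<^sup>2" by (auto simp: abs_square_less_1 abs_less_iff)
    have e: "(1 - t\<^sup>2) powr (a + 1) = (1 - t\<^sup>2) * (1 - t\<^sup>2) powr a"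
      using t by (simp add: powr_add)
    have "((\<lambda>t. (1 - t\<^sup>2) powr (a + 1)) has_real_derivative
        (a + 1) * (1 - t\<^sup>2) powr a * (- 2 * t)) (at t)"
      using t by (auto intro!: derivative_eq_intros)
    moreover have "((\<lambda>t. t ^ Suc (2 * m)) has_real_derivative (1 + real (2 * m)) * (1 * t ^ (2 * m))) (at t)"
      by (rule DERIV_power_Suc[OF DERIV_ident])
    ultimately have "((\<lambda>t. t ^ (2 * m + 1) * (1 - t\<^sup>2) powr (a + 1)) has_real_derivative
        (real (2 * m + 1) * t ^ (2 * m) * (1 - t\<^sup>2) powr (a + 1)
          + t ^ (2 * m + 1) * ((a + 1) * (1 - t\<^sup>2) powr a * (- 2 * t)))) (at t)"
      by (intro DERIV_cong[OF DERIV_mult]) (auto simp: algebra_simps)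
    also have "real (2 * m + 1) * t ^ (2 * m) * (1 - t\<^sup>2) powr (a + 1)
          + t ^ (2 * m + 1) * ((a + 1) * (1 - t\<^sup>2) powr a * (- 2 * t)) = (1 - t\<^sup>2) powr a * poly p t"
      unfolding e by (simp add: p_def poly_monom a_def field_simps power2_eq_square)
    finally show "((\<lambda>t. t ^ (2 * m + 1) * (1 - t\<^sup>2) powr (a + 1)) has_vector_derivative
        (1 - t\<^sup>2) powr a * poly p t) (at t)"
      by (simp add: has_real_derivative_iff_has_vector_derivative)
  qed simp
  then have "((\<lambda>t. (1 - t\<^sup>2) powr a * poly p t) has_integral 0) {-1..1}" by simp
  then have "((\<lambda>t. if t \<in> {-1..1} then (1 - t\<^sup>2) powr a * poly p t else 0) has_integral 0) UNIV"
    by (subst has_integral_restrict_UNIV)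
  also have "(\<lambda>t. if t \<in> {-1..1} then (1 - t\<^sup>2) powr a * poly p t else 0)
      = (\<lambda>t. gegenbauer_density n t * poly p t)"
    by (auto simp: gegenbauer_density_def a_def)
  finally have "(LINT t|lborel. gegenbauer_density n t * poly p t) = 0"
    using has_integral_integral_lborel[OF integrable_density_poly[OF n, of p]] has_integral_unique by blast
  then have "gegenbauer_functional n p = 0" by (simp add: gegenbauer_functional_eq[OF n])
  then show ?thesis by (simp add: p_def diff smult)
qed

lemma gegenbauer_moment:
  assumes n: "n \<ge> 2"
  shows "gegenbauer_functional n (monom 1 (2 * m)) = pochhammer (1 / 2) m / pochhammer (real n / 2) m"
proof (induction m)
  case 0
  then show ?case using gegenbauer_functional_1[OF n] by (simp add: one_poly_eq_simps)
next
  case (Suc m)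
  have "gegenbauer_functional n (monom 1 (2 * Suc m)) =
     (2 * real m + 1) * gegenbauer_functional n (monom 1 (2 * m)) / (real n + 2 * real m)"
    using gegenbauer_moment_Suc[OF n, of m] n by (simp add: field_simps)
  also have "\<dots> = pochhammer (1 / 2) (Suc m) / pochhammer (real n / 2) (Suc m)"
    unfolding Suc pochhammer_Suc using n pochhammer_pos[of "real n / 2" m]
    by (simp add: divide_simps) (simp add: algebra_simps)
  finally show ?case .
qed

section \<open>Gegenbauer polynomials and the Lobatto quadrature rule\<close>

lemma is_gegenbauer_family_orthogonal:
  assumes n: "n \<ge> 2" and P: "is_gegenbauer_family n P"
  shows "is_orthogonal_of_degree (gegenbauer_functional n) l (P l)"
proof -
  interpret even_positive_functional "gegenbauer_functional n"
    by (rule even_positive_functional_gegenbauer[OF n])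
  have P: "\<And>l. degree (P l) = l" "\<And>l. poly (P l) 1 = 1"
    "\<And>l m. l \<noteq> m \<Longrightarrow> gegenbauer_functional n (P l * P m) = 0"
    using P by (auto simp: is_gegenbauer_family_def gegenbauer_functional_def)
  have nz: "P j \<noteq> 0" for j using P(2)[of j] by auto
  have "gegenbauer_functional n (P l * r) = 0" if "\<forall>i\<ge>l. coeff r i = 0" for r
    by (rule vanishes_on_graded_span[where K = "\<lambda>r. gegenbauer_functional n (P l * r)" and Q = P and l = l])
       (use P nz that in \<open>auto simp: distrib_left add smult\<close>)
  then show ?thesis using P nz by (auto simp: is_orthogonal_of_degree_def)
qed

text \<open>
  This makes the definite description of the Gegenbauer polynomials meaningful.
\<close>

lemma ex1_gegenbauer_family:
  assumes n: "n \<ge> 2"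
  shows "\<exists>!P. is_gegenbauer_family n P"
proof -
  interpret even_positive_functional "gegenbauer_functional n"
    by (rule even_positive_functional_gegenbauer[OF n])
  obtain Q where Q: "\<And>l. is_orthogonal_of_degree (gegenbauer_functional n) l (Q l)"
    using ex_orthogonal_of_degree by metis
  define P where "P l = smult (1 / poly (Q l) 1) (Q l)" for l
  have Q1: "poly (Q l) 1 \<noteq> 0" for l using orthogonal_zeros(3)[OF Q[of l]] by auto
  have orth: "gegenbauer_functional n (Q l * Q m) = 0" if "m < l" for l m
    using Q[of l] Q[of m] that by (auto simp: is_orthogonal_of_degree_def coeff_eq_0)
  then have "gegenbauer_functional n (Q l * Q m) = 0" if "m \<noteq> l" for l m
    using that by (metis mult.commute nat_neq_iff)
  then have "gegenbauer_functional n (P l * P m) = 0" if "l \<noteq> m" for l m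
    using that by (simp add: P_def smult)
  moreover have "degree (P l) = l" "poly (P l) 1 = 1" for l
    using Q[of l] Q1[of l] by (auto simp: P_def is_orthogonal_of_degree_def)
  ultimately have "is_gegenbauer_family n P"
    by (simp add: is_gegenbauer_family_def gegenbauer_functional_def)
  moreover have "P' = P''" if "is_gegenbauer_family n P'" "is_gegenbauer_family n P''" for P' P''
    using is_gegenbauer_family_orthogonal[OF n that(1)] is_gegenbauer_family_orthogonal[OF n that(2)] that
    by (intro ext orthogonal_unique) (auto simp: is_gegenbauer_family_def)
  ultimately show ?thesis by blast
qed

lemma gegenbauer_orthogonal:
  "n \<ge> 2 \<Longrightarrow> is_orthogonal_of_degree (gegenbauer_functional n) l (gegenbauer n l)"
  using theI'[OF ex1_gegenbauer_family[of n]]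
  by (intro is_gegenbauer_family_orthogonal) (auto simp: gegenbauer_def)

lemma gegenbauer_zeros:
  fixes n k :: nat and Z :: "real set"
  assumes "n \<ge> 2"
  defines "Z \<equiv> {t. poly (gegenbauer n k) t = 0}"
  shows "finite Z" "card Z = k" "Z \<subseteq> {-1<..<1}" "t \<in> Z \<Longrightarrow> - t \<in> Z"
proof -
  interpret even_positive_functional "gegenbauer_functional n"
    by (rule even_positive_functional_gegenbauer[OF assms(1)])
  note P = gegenbauer_orthogonal[OF assms(1), of k]
  show "finite Z" "card Z = k" "Z \<subseteq> {-1<..<1}"
    using orthogonal_zeros[OF P] by (auto simp: Z_def)
  have "poly (gegenbauer n k) (- t) = (-1) ^ k * poly (gegenbauer n k) t"
    using arg_cong[OF orthogonal_parity[OF P], of "\<lambda>p. poly p t"] by (simp add: poly_pcompose)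
  then show "t \<in> Z \<Longrightarrow> - t \<in> Z" by (simp add: Z_def)
qed

lemma gegenbauer_node_bij:
  fixes n k :: nat and Z :: "real set"
  defines "Z \<equiv> {t. poly (gegenbauer (n + 2) k) t = 0}"
  shows "bij_betw (gegenbauer_node n k) {0..k+1} (insert (-1) (insert 1 Z))"
proof -
  have Z: "finite Z" "card Z = k" "Z \<subseteq> {-1<..<1}"
    using gegenbauer_zeros[where n = "n + 2" and k = k] by (auto simp: Z_def)
  define xs where "xs = sorted_list_of_set Z"
  have "bij_betw ((!) xs) {..<k} Z"
    using Z by (intro bij_betw_nth) (auto simp: xs_def)
  then have "bij_betw ((!) xs \<circ> (\<lambda>i. i - 1)) {1..k} Z"
    by (rule bij_betw_trans[rotated])
       (rule bij_betw_byWitness[where f' = Suc], auto)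
  then have mid: "bij_betw (gegenbauer_node n k) {1..k} Z"
    by (rule bij_betw_cong[THEN iffD1, rotated]) (auto simp: gegenbauer_node_def xs_def Z_def)
  have "bij_betw (gegenbauer_node n k) {0, k + 1} {-1, 1}"
    by (auto simp: bij_betw_def gegenbauer_node_def)
  moreover have "{-1, 1} \<inter> Z = {}" using Z by auto
  ultimately have "bij_betw (gegenbauer_node n k) ({0, k + 1} \<union> {1..k}) ({-1, 1} \<union> Z)"
    using mid by (intro bij_betw_combine)
  moreover have "{0, k + 1} \<union> {1..k} = {0..k+1}" by auto
  moreover have "{-1, 1} \<union> Z = insert (-1) (insert 1 Z)" by simp
  ultimately show ?thesis by (simp only:)
qed

lemma degree_lagrange_basis:
  assumes "finite I" "i \<in> I"
  shows "degree (lagrange_basis x I i) < card I"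
proof -
  have "degree (lagrange_basis x I i) \<le> (\<Sum>j\<in>I - {i}. degree (smult (1 / (x i - x j)) [:- x j, 1:]))"
    unfolding lagrange_basis_def by (rule degree_prod_sum_le[unfolded o_def]) (use assms in simp)
  also have "\<dots> \<le> (\<Sum>j\<in>I - {i}. 1)"
    by (intro sum_mono) (rule order_trans[OF degree_smult_le], simp)
  also have "\<dots> < card I" using assms by (simp add: card_Diff_singleton) (metis card_gt_0_iff diff_less empty_iff zero_less_one One_nat_def)
  finally show ?thesis .
qed

lemma lagrange_interpolation:
  assumes I: "finite I" "inj_on x I" and r: "degree r < card I"
  shows "r = (\<Sum>i\<in>I. smult (poly r (x i)) (lagrange_basis x I i))"
proof (rule poly_eqI_degree)
  fix t assume "t \<in> x ` I"
  then obtain j where j: "j \<in> I" "t = x j" by auto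
  have "poly (\<Sum>i\<in>I. smult (poly r (x i)) (lagrange_basis x I i)) (x j)
      = (\<Sum>i\<in>I. if i = j then poly r (x i) else 0)"
    unfolding poly_sum using poly_lagrange_basis[OF I _ j(1)] by (intro sum.cong) auto
  then show "poly r t = poly (\<Sum>i\<in>I. smult (poly r (x i)) (lagrange_basis x I i)) t"
    using j I by simp
next
  show "degree r < card (x ` I)" using r I by (simp add: card_image)
  show "degree (\<Sum>i\<in>I. smult (poly r (x i)) (lagrange_basis x I i)) < card (x ` I)"
    using r I degree_lagrange_basis[OF I(1)]
    by (auto simp: card_image intro!: degree_sum_less le_less_trans[OF degree_smult_le])
qed

text \<open>
  Divide by the nodal polynomial. Its multiple integrates to \<open>0\<close>: the quotient has degree below
  \<open>k\<close>, and the factor \<open>1 - t\<^sup>2\<close> turns the integral into one against \<open>\<mu>\<^sub>n\<^sub>+\<^sub>2\<close>, for which the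
  remaining factor is orthogonal to lower degrees. The remainder is reproduced by Lagrange
  interpolation and agrees with \<open>p\<close> at the nodes.
\<close>

lemma gegenbauer_lobatto_quadrature:
  assumes n: "n \<ge> 2" and p: "degree p \<le> 2 * k + 1"
  shows "gegenbauer_functional n p =
    (\<Sum>i=0..k+1. gegenbauer_weight n k i * poly p (gegenbauer_node n k i))"
proof -
  interpret even_positive_functional "gegenbauer_functional n"
    by (rule even_positive_functional_gegenbauer[OF n])
  define P where "P = gegenbauer (n + 2) k"
  have P: "degree P = k" "P \<noteq> 0"
    and orth: "\<And>s. (\<forall>i\<ge>k. coeff s i = 0) \<Longrightarrow> gegenbauer_functional (n + 2) (P * s) = 0"
    using gegenbauer_orthogonal[of "n + 2" k] by (auto simp: P_def is_orthogonal_of_degree_def)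
  define w where "w = [:1, 0, -1:] * P"
  have w: "degree w = k + 2" "w \<noteq> 0" 
    using P degree_mult_eq[of "[:1, 0, -1:] :: real poly" P] by (auto simp: w_def simp del: mult_pCons_left)
  define s r where "s = p div w" and "r = p mod w"
  have psr: "p = w * s + r" by (simp add: s_def r_def)
  have degr: "degree r < k + 2" using degree_mod_less[OF w(2), of p] w(1) by (auto simp: r_def)
  have "coeff s i = 0" if "i \<ge> k" for i
  proof (cases "s = 0")
    case False
    have "degree w + degree s = degree (p - r)"
      using degree_mult_eq[OF w(2) False] psr by simp
    also have "\<dots> \<le> 2 * k + 1" using p degr by (intro degree_diff_le) auto
    finally show ?thesis using w that by (intro coeff_eq_0) auto
  qed simp
  then have "gegenbauer_functional n (w * s) = 0"
    unfolding w_def mult.assoc gegenbauer_functional_shift[OF n] using orth[of s] by simp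
  then have "gegenbauer_functional n p = gegenbauer_functional n r"
    by (simp add: psr add)
  also have inj: "inj_on (gegenbauer_node n k) {0..k+1}"
    using gegenbauer_node_bij by (rule bij_betw_imp_inj_on)
  have "gegenbauer_functional n r = gegenbauer_functional n
     (\<Sum>i=0..k+1. smult (poly r (gegenbauer_node n k i)) (lagrange_basis (gegenbauer_node n k) {0..k+1} i))"
    using lagrange_interpolation[OF _ inj, of r] degr by simp
  also have "\<dots> = (\<Sum>i=0..k+1. gegenbauer_weight n k i * poly r (gegenbauer_node n k i))"
    unfolding sum smult by (simp only: gegenbauer_weight_def gegenbauer_functional_def mult.commute)
  also have "\<dots> = (\<Sum>i=0..k+1. gegenbauer_weight n k i * poly p (gegenbauer_node n k i))"
  proof (intro sum.cong refl)
    fix i assume "i \<in> {0..k+1}"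
    then have "gegenbauer_node n k i \<in> insert (-1) (insert 1 {t. poly P t = 0})"
      using gegenbauer_node_bij[of n k] unfolding P_def bij_betw_def by blast
    then have "poly w (gegenbauer_node n k i) = 0" by (auto simp: w_def)
    then show "gegenbauer_weight n k i * poly r (gegenbauer_node n k i)
        = gegenbauer_weight n k i * poly p (gegenbauer_node n k i)" by (simp add: psr)
  qed
  finally show ?thesis .
qed

section \<open>Gaussian moment tensors\<close>

definition std_gaussian :: "real measure" where
  "std_gaussian = density lborel (\<lambda>x. ennreal (std_normal_density x))"

lemma prob_space_std_gaussian: "prob_space std_gaussian"
  unfolding std_gaussian_def by (rule prob_space_normal_density) simp

lemma sets_std_gaussian [measurable_cong, simp]: "sets std_gaussian = sets borel"
  by (simp add: std_gaussian_def)

text \<open>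
  The even moments of a standard normal variable; in the usual notation this is \<open>(2 m - 1)!!\<close>. The
  Pochhammer form makes the comparison with the moments of \<open>\<mu>\<^sub>n\<close> immediate.
\<close>

definition gaussian_moment :: "nat \<Rightarrow> real" where
  "gaussian_moment m = 2 ^ m * pochhammer (1 / 2) m"

lemma gaussian_moment_pos: "gaussian_moment m > 0"
  by (simp add: gaussian_moment_def pochhammer_pos)

lemma gaussian_moment_eq: "gaussian_moment m = fact (2 * m) / (2 ^ m * fact m)"
proof -
  have "(2::real) ^ (2 * m) = 2 ^ m * 2 ^ m" by (simp add: mult_2 power_add)
  then show ?thesis by (simp add: gaussian_moment_def fact_double)
qed

lemma integrable_std_gaussian_power: "integrable std_gaussian (\<lambda>x. x ^ k)"
  unfolding std_gaussian_def
  by (subst integrable_density) (auto simp: integrable_std_normal_moment)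

lemma integral_std_gaussian_power:
  "(LINT x|std_gaussian. x ^ k) = (if even k then gaussian_moment (k div 2) else 0)"
proof -
  have *: "(LINT x|std_gaussian. x ^ k) = (LINT x|lborel. std_normal_density x * x ^ k)"
    unfolding std_gaussian_def by (subst integral_density) auto
  show ?thesis
  proof (cases "even k")
    case True
    then obtain m where "k = 2 * m" by auto
    then show ?thesis
      unfolding * using integral_std_normal_moment_even[of m] by (simp add: gaussian_moment_eq)
  next
    case False
    then obtain m where "k = 2 * m + 1" by (auto elim: oddE)
    then show ?thesis
      unfolding * using integral_std_normal_moment_odd[of m] by simp
  qed
qed

abbreviation gaussian_space :: "'i set \<Rightarrow> ('i \<Rightarrow> real) measure" where
  "gaussian_space I \<equiv> PiM I (\<lambda>_. std_gaussian)"

interpretation gaussian: product_prob_space "\<lambda>_. std_gaussian" I for I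
  by (rule product_prob_spaceI) (rule prob_space_std_gaussian)

text \<open>
  A power of a sum, expanded over index functions instead of exponents. The products on the right are
  the entries of a tensor power, and no multinomial coefficients occur.
\<close>

lemma power_sum_expand:
  fixes u :: "'i \<Rightarrow> real"
  assumes "finite I"
  shows "(\<Sum>a\<in>I. u a) ^ M = (\<Sum>f\<in>{..<M} \<rightarrow>\<^sub>E I. \<Prod>i<M. u (f i))"
  using prod_sum_PiE[of "{..<M}" "\<lambda>_. I" "\<lambda>_. u"] assms by simp

lemma integrable_gaussian_power_sum:
  fixes g :: "'i \<Rightarrow> real \<Rightarrow> real"
  assumes I: "finite I" and g: "\<And>a j. integrable std_gaussian (\<lambda>y. g a y ^ j)"
  shows "integrable (gaussian_space I) (\<lambda>\<omega>. (\<Sum>a\<in>I. g a (\<omega> a)) ^ M)"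
    and "f \<in> {..<M} \<rightarrow>\<^sub>E I \<Longrightarrow> integrable (gaussian_space I) (\<lambda>\<omega>. \<Prod>i<M. g (f i) (\<omega> (f i)))"
proof -
  show *: "integrable (gaussian_space I) (\<lambda>\<omega>. \<Prod>i<M. g (f i) (\<omega> (f i)))"
    if f: "f \<in> {..<M} \<rightarrow>\<^sub>E I" for f
  proof -
    have "(\<Prod>i<M. g (f i) (\<omega> (f i))) = (\<Prod>a\<in>I. g a (\<omega> a) ^ card {i. i < M \<and> f i = a})" for \<omega>
    proof -
      have "(\<Prod>i<M. g (f i) (\<omega> (f i))) = (\<Prod>a\<in>I. \<Prod>i\<in>{i\<in>{..<M}. f i = a}. g (f i) (\<omega> (f i)))"
        using f I by (intro prod.group[symmetric]) auto
      also have "\<dots> = (\<Prod>a\<in>I. g a (\<omega> a) ^ card {i. i < M \<and> f i = a})"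
        by (intro prod.cong refl) simp
      finally show ?thesis .
    qed
    then show ?thesis
      using gaussian.product_integrable_prod[OF I, of "\<lambda>a y. g a y ^ card {i. i < M \<and> f i = a}"] g by simp
  qed
  show "integrable (gaussian_space I) (\<lambda>\<omega>. (\<Sum>a\<in>I. g a (\<omega> a)) ^ M)"
    unfolding power_sum_expand[OF I] by (intro Bochner_Integration.integrable_sum *)
qed

text \<open>
  Fubini in one coordinate followed by the binomial theorem. The functions \<open>g\<close> are arbitrary so
  that the recursion serves both for linear forms and for the squared norm.
\<close>

lemma gaussian_power_sum_insert:
  fixes g :: "'i \<Rightarrow> real \<Rightarrow> real"
  assumes I: "finite I" "b \<notin> I" and g: "\<And>a j. integrable std_gaussian (\<lambda>y. g a y ^ j)"
  shows "(LINT \<omega>|gaussian_space (insert b I). (\<Sum>a\<in>insert b I. g a (\<omega> a)) ^ M) =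
    (\<Sum>j\<le>M. of_nat (M choose j) * (LINT y|std_gaussian. g b y ^ j) *
      (LINT \<omega>|(gaussian_space I). (\<Sum>a\<in>I. g a (\<omega> a)) ^ (M - j)))"
proof -
  have inner: "(LINT y|std_gaussian. (\<Sum>a\<in>insert b I. g a ((fun_upd \<omega> b y) a)) ^ M) =
    (\<Sum>j\<le>M. of_nat (M choose j) * (LINT y|std_gaussian. g b y ^ j) * (\<Sum>a\<in>I. g a (\<omega> a)) ^ (M - j))" for \<omega>
  proof -
    have "(\<Sum>a\<in>insert b I. g a ((fun_upd \<omega> b y) a)) = g b y + (\<Sum>a\<in>I. g a (\<omega> a))" for y
    proof -
      have "(\<Sum>a\<in>I. g a ((fun_upd \<omega> b y) a)) = (\<Sum>a\<in>I. g a (\<omega> a))"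
        using I by (intro sum.cong) auto
      then show ?thesis using I by simp
    qed
    then have "(LINT y|std_gaussian. (\<Sum>a\<in>insert b I. g a ((fun_upd \<omega> b y) a)) ^ M) =
      (LINT y|std_gaussian. (\<Sum>j\<le>M. of_nat (M choose j) * (\<Sum>a\<in>I. g a (\<omega> a)) ^ (M - j) * g b y ^ j))"
      by (simp add: binomial_ring mult_ac)
    also have "\<dots> = (\<Sum>j\<le>M. of_nat (M choose j) * (\<Sum>a\<in>I. g a (\<omega> a)) ^ (M - j) * (LINT y|std_gaussian. g b y ^ j))"
      using g by (subst Bochner_Integration.integral_sum) auto
    finally show ?thesis by (simp add: mult_ac)
  qed
  show ?thesis
    unfolding gaussian.product_integral_insert[OF I integrable_gaussian_power_sum(1)[OF _ g], OF finite.insertI[OF I(1)]] inner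
    using integrable_gaussian_power_sum(1)[OF I(1) g]
    by (subst Bochner_Integration.integral_sum) auto
qed

lemma gaussian_moment_convolution:
  assumes "j \<le> m"
  shows "of_nat ((2 * m) choose (2 * j)) * gaussian_moment j * gaussian_moment (m - j)
       = of_nat (m choose j) * gaussian_moment m"
proof -
  have "2 * m - 2 * j = 2 * (m - j)" by simp
  moreover have "(2::real) ^ m = 2 ^ j * 2 ^ (m - j)" using assms by (simp flip: power_add)
  ultimately show ?thesis using assms
    by (simp add: gaussian_moment_eq binomial_fact)
qed

lemma sum_even_terms:
  fixes t :: "nat \<Rightarrow> real"
  assumes "\<And>j. odd j \<Longrightarrow> t j = 0"
  shows "(\<Sum>j\<le>2 * m. t j) = (\<Sum>j\<le>m. t (2 * j))"
  by (induction m) (auto simp: assms)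

text \<open>
  A linear form in a standard Gaussian vector is normal with variance the sum of the squared
  coefficients. Only its moments are needed, and these follow by induction on the coordinates, since
  the even moments convolve like powers (\<open>gaussian_moment_convolution\<close>).
\<close>

lemma gaussian_linear_form_moment:
  fixes x :: "'i \<Rightarrow> real"
  assumes "finite I"
  shows "(LINT \<omega>|(gaussian_space I). (\<Sum>a\<in>I. x a * \<omega> a) ^ M) =
     (if even M then gaussian_moment (M div 2) * (\<Sum>a\<in>I. (x a)\<^sup>2) ^ (M div 2) else 0)"
  using assms
proof (induction I arbitrary: M)
  case empty
  show ?case
  proof (cases "M = 0")
    case True
    then show ?thesis
      by (simp add: gaussian_moment_def PiM_empty lebesgue_integral_count_space_finite)
  qed (auto simp: power_0_left)
next
  case (insert b I)
  have int: "integrable std_gaussian (\<lambda>y. (x a * y) ^ j)" for a j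
    by (simp add: power_mult_distrib integrable_std_gaussian_power)
  have int_b: "(LINT y|std_gaussian. (x b * y) ^ j) = x b ^ j * (if even j then gaussian_moment (j div 2) else 0)" for j
    by (simp add: power_mult_distrib integral_std_gaussian_power)
  define r where "r = (\<Sum>a\<in>I. (x a)\<^sup>2)"
  define t where "t j = of_nat (M choose j) * (x b ^ j * (if even j then gaussian_moment (j div 2) else 0)) *
     (if even (M - j) then gaussian_moment ((M - j) div 2) * r ^ ((M - j) div 2) else 0)" for j
  have eq: "(LINT \<omega>|gaussian_space (insert b I). (\<Sum>a\<in>insert b I. x a * \<omega> a) ^ M) = (\<Sum>j\<le>M. t j)"
    by (subst gaussian_power_sum_insert[OF insert.hyps int])
       (simp only: int_b insert.IH t_def[abs_def] r_def)
  show ?case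
  proof (cases "even M")
    case False
    have "t j = 0" if "j \<le> M" for j
      using False that by (auto simp: t_def)
    then show ?thesis using False eq by simp
  next
    case True
    then obtain m where M: "M = 2 * m" by auto
    have "(\<Sum>j\<le>M. t j) = (\<Sum>j\<le>m. t (2 * j))"
      unfolding M by (rule sum_even_terms) (simp add: t_def)
    also have "\<dots> = (\<Sum>j\<le>m. gaussian_moment m * (of_nat (m choose j) * ((x b)\<^sup>2) ^ j * r ^ (m - j)))"
    proof (intro sum.cong refl)
      fix j assume "j \<in> {..m}"
      then have j: "j \<le> m" by simp
      have "2 * m - 2 * j = 2 * (m - j)" by simp
      then have "t (2 * j) = (of_nat ((2 * m) choose (2 * j)) * gaussian_moment j * gaussian_moment (m - j))
          * (((x b)\<^sup>2) ^ j * r ^ (m - j))"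
        by (simp add: t_def M power_mult)
      then show "t (2 * j) = gaussian_moment m * (of_nat (m choose j) * ((x b)\<^sup>2) ^ j * r ^ (m - j))"
        unfolding gaussian_moment_convolution[OF j] by simp
    qed
    also have "\<dots> = gaussian_moment m * ((x b)\<^sup>2 + r) ^ m"
      by (simp add: binomial_ring sum_distrib_left)
    finally show ?thesis using insert.hyps eq by (simp add: M r_def)
  qed
qed

text \<open>
  The moments of a chi-squared variable; the induction step is the Vandermonde identity for rising
  factorials.
\<close>

lemma gaussian_norm_moment:
  assumes "finite I"
  shows "(LINT \<omega>|(gaussian_space I). (\<Sum>a\<in>I. (\<omega> a)\<^sup>2) ^ m) =
     2 ^ m * pochhammer (real (card I) / 2) m"
  using assms
proof (induction I arbitrary: m)
  case empty
  show ?case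
  proof (cases "m = 0")
    case True
    then show ?thesis by (simp add: PiM_empty lebesgue_integral_count_space_finite)
  next
    case False
    then show ?thesis by (simp add: pochhammer_0_left)
  qed
next
  case (insert b I)
  have int: "integrable std_gaussian (\<lambda>y. (y\<^sup>2) ^ j)" for j
    by (simp add: integrable_std_gaussian_power flip: power_mult)
  have int_b: "(LINT y|std_gaussian. (y\<^sup>2) ^ j) = gaussian_moment j" for j
    by (simp add: integral_std_gaussian_power flip: power_mult)
  have "(LINT \<omega>|gaussian_space (insert b I). (\<Sum>a\<in>insert b I. (\<omega> a)\<^sup>2) ^ m) =
      (\<Sum>j\<le>m. of_nat (m choose j) * gaussian_moment j * (2 ^ (m - j) * pochhammer (real (card I) / 2) (m - j)))"
    by (subst gaussian_power_sum_insert[OF insert.hyps int]) (simp add: int_b insert.IH)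
  also have "\<dots> = (\<Sum>j\<le>m. 2 ^ m * (of_nat (m choose j) * pochhammer (1 / 2) j * pochhammer (real (card I) / 2) (m - j)))"
  proof (intro sum.cong refl)
    fix j assume "j \<in> {..m}"
    then have "(2::real) ^ m = 2 ^ j * 2 ^ (m - j)" by (simp flip: power_add)
    then show "of_nat (m choose j) * gaussian_moment j * (2 ^ (m - j) * pochhammer (real (card I) / 2) (m - j))
      = 2 ^ m * (of_nat (m choose j) * pochhammer (1 / 2) j * pochhammer (real (card I) / 2) (m - j))"
      by (simp add: gaussian_moment_def)
  qed
  also have "\<dots> = 2 ^ m * pochhammer (1 / 2 + real (card I) / 2) m"
    by (simp add: pochhammer_binomial_sum sum_distrib_left)
  also have "1 / 2 + real (card I) / 2 = real (card (insert b I)) / 2"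
    using insert.hyps by (simp add: field_simps)
  finally show ?case .
qed

text \<open>
  The constant \<open>c m\<close> is the average of \<open>(x \<bullet> y)\<^bsup>2m\<^esup>\<close> over unit vectors \<open>y\<close>. The proof works in the
  space of tensors of order \<open>2 m\<close>, where \<open>v y\<close> is the tensor power of \<open>y\<close> and
  \<open>(y \<bullet> z)\<^bsup>2m\<^esup>\<close> is the inner product of \<open>v y\<close> and \<open>v z\<close>. The Gaussian moment tensor \<open>e\<close> has the same
  inner product with the tensor powers of all unit vectors, so a suitable multiple of it is the
  average tensor power over the sphere. The assumption on the double sum says that the sum of the
  \<open>v y\<close> over \<open>C\<close> has distance \<open>0\<close> from that multiple; pairing with \<open>v x\<close> then gives the claim.
\<close>

lemma unit_vectors_moment_pointwise:
  fixes C :: "(real^'n) set" and x :: "real^'n"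
  defines "c \<equiv> \<lambda>m. pochhammer (1 / 2) m / pochhammer (real CARD('n) / 2) m"
  assumes C: "finite C" "C \<subseteq> sphere 0 1" and x: "norm x = 1"
    and energy: "(\<Sum>y\<in>C. \<Sum>z\<in>C. (y \<bullet> z) ^ (2 * m)) = (real (card C))\<^sup>2 * c m"
  shows "(\<Sum>y\<in>C. (x \<bullet> y) ^ (2 * m)) = real (card C) * c m"
proof -
  define G where "G = gaussian_space (UNIV::'n set)"
  define F where "F = {..<2 * m} \<rightarrow>\<^sub>E (UNIV :: 'n set)"
  define v where "v u f = (\<Prod>i<2 * m. u (f i))" for u :: "'n \<Rightarrow> real" and f :: "nat \<Rightarrow> 'n"
  define e where "e f = (LINT \<omega>|G. v \<omega> f)" for f
  define s where "s = gaussian_moment m"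
  define N where "N = real (card C)"
  have finF: "finite F" unfolding F_def by (intro finite_PiE) auto
  have kernel: "(\<Sum>a\<in>UNIV. u a * w a) ^ (2 * m) = (\<Sum>f\<in>F. v u f * v w f)" for u w
    unfolding F_def v_def by (subst power_sum_expand) (auto simp: prod.distrib)
  have inner: "(y \<bullet> z) ^ (2 * m) = (\<Sum>f\<in>F. v (($) y) f * v (($) z) f)" for y z :: "real^'n"
    by (simp add: inner_vec_def kernel)
  have int_id: "integrable std_gaussian (\<lambda>y. y ^ j)" for j by (rule integrable_std_gaussian_power)
  have int_v: "integrable G (\<lambda>\<omega>. v \<omega> f)" if "f \<in> F" for f
    unfolding G_def v_def
    using that int_id by (intro integrable_gaussian_power_sum(2)[where g = "\<lambda>_ y. y"]) (auto simp: F_def)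
  have e_v: "(\<Sum>f\<in>F. e f * v u f) = s * (\<Sum>a\<in>UNIV. (u a)\<^sup>2) ^ m" for u
  proof -
    have "(\<Sum>f\<in>F. e f * v u f) = (LINT \<omega>|G. (\<Sum>f\<in>F. v u f * v \<omega> f))"
      using int_v by (subst Bochner_Integration.integral_sum) (auto simp: e_def mult.commute)
    also have "\<dots> = s * (\<Sum>a\<in>UNIV. (u a)\<^sup>2) ^ m"
      unfolding kernel[symmetric] G_def s_def by (subst gaussian_linear_form_moment) auto
    finally show ?thesis .
  qed
  have e_unit: "(\<Sum>f\<in>F. e f * v (($) y) f) = s" if "norm y = 1" for y :: "real^'n"
  proof -
    have "(\<Sum>a\<in>UNIV. (y $ a)\<^sup>2) = 1"
      using that by (simp add: norm_eq_1 inner_vec_def power2_eq_square)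
    then show ?thesis by (simp add: e_v)
  qed
  have e_e: "(\<Sum>f\<in>F. e f * e f) = s * (2 ^ m * pochhammer (real CARD('n) / 2) m)"
  proof -
    have "(\<Sum>f\<in>F. e f * e f) = (LINT \<omega>|G. (\<Sum>f\<in>F. e f * v \<omega> f))"
      using int_v by (subst Bochner_Integration.integral_sum) (auto simp: e_def)
    also have "\<dots> = s * (LINT \<omega>|G. (\<Sum>a\<in>UNIV. (\<omega> a)\<^sup>2) ^ m)" by (simp add: e_v)
    finally show ?thesis unfolding G_def by (simp add: gaussian_norm_moment)
  qed
  have s: "s > 0" "s = 2 ^ m * pochhammer (1 / 2) m"
    by (simp_all only: s_def gaussian_moment_pos) (simp add: gaussian_moment_def)
  have p: "pochhammer (real CARD('n) / 2) m > 0" by (rule pochhammer_pos) simp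
  \<comment> \<open>This factor makes the pairing of \<open>\<kappa> e\<close> with each unit tensor power equal to \<open>N c\<^sub>m\<close>, and it also
    makes the squared norm of \<open>\<kappa> e\<close> equal to \<open>N\<^sup>2 c\<^sub>m\<close>, so that the three terms of the expanded square
    cancel.\<close>
  define \<kappa> where "\<kappa> = N * c m / s"
  define T where "T f = (\<Sum>y\<in>C. v (($) y) f) - \<kappa> * e f" for f
  have TT: "T f * T f = (\<Sum>y\<in>C. \<Sum>z\<in>C. v (($) y) f * v (($) z) f)
      - 2 * \<kappa> * (\<Sum>y\<in>C. e f * v (($) y) f) + \<kappa>\<^sup>2 * (e f * e f)" for f
    by (simp add: T_def sum_product sum_distrib_left[symmetric] power2_eq_square algebra_simps)
  have "(\<Sum>f\<in>F. T f * T f) =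
      (\<Sum>f\<in>F. \<Sum>y\<in>C. \<Sum>z\<in>C. v (($) y) f * v (($) z) f)
      - 2 * \<kappa> * (\<Sum>f\<in>F. \<Sum>y\<in>C. e f * v (($) y) f) + \<kappa>\<^sup>2 * (\<Sum>f\<in>F. e f * e f)"
    by (simp add: TT sum.distrib sum_subtractf sum_distrib_left)
  also have "(\<Sum>f\<in>F. \<Sum>y\<in>C. \<Sum>z\<in>C. v (($) y) f * v (($) z) f) = N\<^sup>2 * c m"
    unfolding energy[folded N_def, symmetric] inner
    by (subst sum.swap, intro sum.cong refl, subst sum.swap, rule refl)
  also have "(\<Sum>f\<in>F. \<Sum>y\<in>C. e f * v (($) y) f) = N * s"
  proof -
    have "(\<Sum>f\<in>F. \<Sum>y\<in>C. e f * v (($) y) f) = (\<Sum>y\<in>C. s)"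
      using C(2) by (subst sum.swap, intro sum.cong refl e_unit) auto
    then show ?thesis by (simp add: N_def)
  qed
  also have "N\<^sup>2 * c m - 2 * \<kappa> * (N * s) + \<kappa>\<^sup>2 * (\<Sum>f\<in>F. e f * e f) = 0"
    unfolding e_e s(2) using p pochhammer_pos[of "1 / 2 :: real" m] by (simp add: s(2) \<kappa>_def c_def field_simps power2_eq_square)
  finally have "(\<Sum>f\<in>F. T f * T f) = 0" .
  then have T0: "T f = 0" if "f \<in> F" for f
    using that finF by (subst (asm) sum_nonneg_eq_0_iff) auto
  have "(\<Sum>y\<in>C. (x \<bullet> y) ^ (2 * m)) = (\<Sum>f\<in>F. v (($) x) f * (\<Sum>y\<in>C. v (($) y) f))"
    unfolding inner sum_distrib_left by (rule sum.swap)
  also have "\<dots> = (\<Sum>f\<in>F. \<kappa> * (e f * v (($) x) f))"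
    using T0 by (intro sum.cong refl) (simp add: T_def)
  also have "\<dots> = \<kappa> * s" by (simp add: e_unit[OF x] flip: sum_distrib_left)
  also have "\<dots> = N * c m" using s(1) by (simp add: \<kappa>_def)
  finally show ?thesis by (simp add: N_def)
qed

section \<open>Hermite interpolation from above\<close>

text \<open>
  Rolle's theorem between consecutive zeros. The new zeros are kept disjoint from \<open>A\<close>, so that double
  zeros in \<open>A\<close> can be counted in addition; to this end the induction adds points from left to right.
\<close>

lemma rolle_zeros:
  fixes f f' :: "real \<Rightarrow> real"
  assumes S: "is_interval S" "S \<subseteq> {a..b}" "continuous_on S f"
    and deriv: "\<And>x. a < x \<Longrightarrow> x < b \<Longrightarrow> (f has_real_derivative f' x) (at x)"
    and A: "finite A" "A \<noteq> {}" "A \<subseteq> S" "\<And>x. x \<in> A \<Longrightarrow> f x = 0"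
  shows "\<exists>B. finite B \<and> B \<subseteq> {a<..<b} \<and> B \<inter> A = {} \<and> Suc (card B) = card A \<and>
           (\<forall>x\<in>B. f' x = 0)"
proof -
  have "A \<noteq> {} \<longrightarrow> A \<subseteq> S \<longrightarrow> (\<forall>x\<in>A. f x = 0) \<longrightarrow>
    (\<exists>B. finite B \<and> B \<subseteq> {a<..<b} \<and> B \<inter> A = {} \<and> Suc (card B) = card A \<and>
           (\<forall>x\<in>B. f' x = 0 \<and> x < Max A))"
    using A(1)
  proof (induction rule: finite_linorder_max_induct)
    case empty
    then show ?case by simp
  next
    case (insert c A)
    show ?case
    proof (cases "A = {}")
      case True
      then show ?thesis by (intro impI exI[of _ "{}"]) auto
    next
      case False
      show ?thesis
      proof (intro impI)
        assume A: "insert c A \<subseteq> S" "\<forall>x\<in>insert c A. f x = 0"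
        then obtain B where B: "finite B" "B \<subseteq> {a<..<b}" "B \<inter> A = {}" "Suc (card B) = card A"
          "\<forall>x\<in>B. f' x = 0 \<and> x < Max A"
          using insert.IH False by auto
        define m where "m = Max A"
        have m: "m \<in> A" "m < c" "\<And>x. x \<in> A \<Longrightarrow> x \<le> m"
          using insert.hyps False by (auto simp: m_def)
        have sub: "{m..c} \<subseteq> S"
          using mem_is_interval_1_I[OF S(1), of m c] A(1) m(1) by auto
        have "a \<le> m" "c \<le> b" using S(2) A m(1) by auto
        have "\<exists>z>m. z < c \<and> (\<lambda>x v. v * f' x) z = (\<lambda>v. 0)"
        proof (rule Rolle_deriv)
          show "m < c" by (rule m)
          show "f m = f c" using A m by simp
          show "continuous_on {m..c} f" using S(3) sub by (rule continuous_on_subset)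
          show "(f has_derivative (\<lambda>v. v * f' x)) (at x)" if "m < x" "x < c" for x
            using deriv[of x] that \<open>a \<le> m\<close> \<open>c \<le> b\<close>
            by (simp add: has_field_derivative_def mult_commute_abs)
        qed
        then obtain z where z: "m < z" "z < c" "(\<lambda>v. v * f' z) = (\<lambda>v. 0)" by auto
        from fun_cong[OF z(3), of 1] have "f' z = 0" by simp
        have "Max (insert c A) = c" using insert.hyps False m by (intro Max_eqI) auto
        moreover have "z \<notin> B" using B(5) z(1) by (auto simp flip: m_def)
        moreover have "z \<notin> A" using m(3)[of z] z(1) by auto
        moreover have "c \<notin> B" using B(5) m(2) by (auto simp flip: m_def)
        moreover have "c \<notin> A" using insert.hyps(2) by auto
        ultimately have "insert z B \<inter> insert c A = {}" "Suc (card (insert z B)) = card (insert c A)"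
          "Max (insert c A) = c"
          using B(1,3,4) z insert.hyps(1) by auto
        moreover have "insert z B \<subseteq> {a<..<b}"
          using B(2) z \<open>a \<le> m\<close> \<open>c \<le> b\<close> by simp
        moreover have "\<forall>x\<in>insert z B. f' x = 0 \<and> x < c"
          using B(5) z m(2) \<open>f' z = 0\<close> by (auto simp flip: m_def)
        ultimately show "\<exists>B. finite B \<and> B \<subseteq> {a<..<b} \<and> B \<inter> insert c A = {} \<and>
            Suc (card B) = card (insert c A) \<and> (\<forall>x\<in>B. f' x = 0 \<and> x < Max (insert c A))"
          using B(1) by (intro exI[of _ "insert z B"]) simp
      qed
    qed
  qed
  then show ?thesis using A by blast
qed

lemma iterated_rolle:
  fixes D :: "nat \<Rightarrow> real \<Rightarrow> real"
  assumes "\<And>j x. j < m \<Longrightarrow> a < x \<Longrightarrow> x < b \<Longrightarrow> (D j has_real_derivative D (Suc j) x) (at x)"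
    and "finite A" "A \<subseteq> {a<..<b}" "card A > m" "\<And>x. x \<in> A \<Longrightarrow> D 0 x = 0"
  shows "\<exists>x. a < x \<and> x < b \<and> D m x = 0"
  using assms
proof (induction m arbitrary: D A)
  case 0
  then obtain x where "x \<in> A" by (metis card_gt_0_iff ex_in_conv)
  with 0 show ?case by (intro exI[of _ x]) auto
next
  case (Suc m)
  have cont: "continuous_on {a<..<b} (D 0)"
  proof (intro continuous_at_imp_continuous_on ballI)
    fix x assume "x \<in> {a<..<b}"
    then show "isCont (D 0) x" using DERIV_isCont[OF Suc.prems(1)[of 0 x]] by simp
  qed
  have "{a<..<b} \<subseteq> {a..b}" "A \<noteq> {}" using Suc.prems(4) by auto
  moreover have "(D 0 has_real_derivative D 1 x) (at x)" if "a < x" "x < b" for x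
    using Suc.prems(1)[of 0 x] that by simp
  ultimately have "\<exists>B. finite B \<and> B \<subseteq> {a<..<b} \<and> B \<inter> A = {} \<and> Suc (card B) = card A \<and>
      (\<forall>x\<in>B. D 1 x = 0)"
    using Suc.prems(2,3,5) cont
    by (intro rolle_zeros[OF is_interval_oo, of a b a b "D 0"]) blast+
  then obtain B where B: "finite B" "B \<subseteq> {a<..<b}" "Suc (card B) = card A" "\<And>x. x \<in> B \<Longrightarrow> D 1 x = 0"
    by metis
  have "card B > m" using B(3) Suc.prems(4) by simp
  moreover have "(D (Suc j) has_real_derivative D (Suc (Suc j)) x) (at x)"
    if "j < m" "a < x" "x < b" for j x
    using Suc.prems(1)[of "Suc j" x] that by simp
  ultimately show ?case
    using B Suc.IH[of "\<lambda>j. D (Suc j)" B] by simp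
qed

lemma ex_lagrange_interpolant:
  fixes f :: "real \<Rightarrow> real"
  assumes "finite A"
  shows "\<exists>p. (\<forall>i\<ge>card A. coeff p i = 0) \<and> (\<forall>a\<in>A. poly p a = f a)"
  using assms
proof (induction A)
  case empty
  show ?case by (intro exI[of _ 0]) simp
next
  case (insert b A)
  then obtain p where p: "\<forall>i\<ge>card A. coeff p i = 0" "\<forall>a\<in>A. poly p a = f a" by blast
  define w where "w = (\<Prod>a\<in>A. [:- a, 1:])"
  have w: "poly w b \<noteq> 0" "\<And>a. a \<in> A \<Longrightarrow> poly w a = 0" "degree w = card A"
    using insert.hyps by (auto simp: w_def poly_prod degree_prod_eq_sum_degree)
  show ?case
    by (intro exI[of _ "p + smult ((f b - poly p b) / poly w b) w"])
       (use p w insert.hyps in \<open>auto simp: coeff_eq_0\<close>)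
qed

lemma poly_pderiv_nodal:
  assumes "finite A" "v \<in> A"
  shows "poly (pderiv (\<Prod>a\<in>A. [:- a, 1:])) v = (\<Prod>a\<in>A - {v}. v - a :: real)"
  by (subst prod.remove[OF assms])
     (simp add: pderiv_mult pderiv_pCons poly_prod del: mult_pCons_left)

text \<open>
  Newton's two-step construction: correct the Lagrange interpolant by a multiple of the nodal
  polynomial \<open>w\<close>, which leaves the values on \<open>U\<close> unchanged. As \<open>w\<close> has simple zeros, the derivative
  conditions become interpolation conditions on the cofactor.
\<close>

lemma ex_hermite_interpolant:
  fixes f d :: "real \<Rightarrow> real"
  assumes U: "finite U" and V: "V \<subseteq> U"
  shows "\<exists>p. (\<forall>i\<ge>card U + card V. coeff p i = 0) \<and>
             (\<forall>u\<in>U. poly p u = f u) \<and> (\<forall>v\<in>V. poly (pderiv p) v = d v)"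
proof -
  have finV: "finite V" using U V by (rule finite_subset[rotated])
  obtain p0 where p0: "\<forall>i\<ge>card U. coeff p0 i = 0" "\<forall>u\<in>U. poly p0 u = f u"
    using ex_lagrange_interpolant[OF U, of f] by blast
  define w where "w = (\<Prod>a\<in>U. [:- a, 1:])"
  have w: "\<And>u. u \<in> U \<Longrightarrow> poly w u = 0" "\<And>u. u \<in> U \<Longrightarrow> poly (pderiv w) u \<noteq> 0"
    "degree w = card U" "w \<noteq> 0"
    using U by (auto simp: w_def poly_prod degree_prod_eq_sum_degree poly_pderiv_nodal)
  obtain s where s: "\<forall>i\<ge>card V. coeff s i = 0"
    "\<forall>v\<in>V. poly s v = (d v - poly (pderiv p0) v) / poly (pderiv w) v"
    using ex_lagrange_interpolant[OF finV, of "\<lambda>v. (d v - poly (pderiv p0) v) / poly (pderiv w) v"] by blast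
  have cws: "coeff (w * s) i = 0" if "i \<ge> card U + card V" for i
  proof (cases "s = 0")
    case False
    then have "degree s < card V" using s(1) by (meson leading_coeff_0_iff not_le)
    then show ?thesis using that w False by (intro coeff_eq_0) (simp add: degree_mult_eq)
  qed simp
  show ?thesis
  proof (intro exI[of _ "p0 + w * s"] conjI)
    show "\<forall>v\<in>V. poly (pderiv (p0 + w * s)) v = d v"
      using s(2) w(1,2) V by (auto simp: pderiv_add pderiv_mult)
  qed (use p0 w cws in auto)
qed

lemma pderiv_funpow_degree:
  fixes q :: "real poly"
  assumes "\<And>i. i > m \<Longrightarrow> coeff q i = 0"
  shows "(pderiv ^^ m) q = [:fact m * coeff q m:]"
  using assms
proof (induction m arbitrary: q)
  case 0
  then show ?case by (auto simp: poly_eq_iff coeff_pCons split: nat.split)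
next
  case (Suc m)
  have "(pderiv ^^ m) (pderiv q) = [:fact m * coeff (pderiv q) m:]"
    using Suc.prems by (intro Suc.IH) (simp add: coeff_pderiv)
  then show ?case by (simp add: funpow_Suc_right coeff_pderiv mult_ac del: funpow.simps)
qed

text \<open>
  The error formula for Hermite interpolation, with nodes \<open>U\<close> of which those in \<open>V\<close> are double. Simple
  nodes may be endpoints, where \<open>f\<close> is only continuous. The functions \<open>D j\<close> are the successive
  derivatives. For fixed \<open>x\<close> subtract the multiple of the nodal polynomial that makes the error vanish
  at \<open>x\<close> too; the first derivative then has \<open>m\<close> distinct zeros, namely those from Rolle's theorem and
  the points of \<open>V\<close>, and so the derivative of order \<open>m\<close> has a zero. There \<open>D m\<close> equals \<open>m!\<close> times the multiplier.
\<close>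

lemma hermite_error:
  fixes f :: "real \<Rightarrow> real" and D :: "nat \<Rightarrow> real \<Rightarrow> real" and p :: "real poly"
  assumes U: "finite U" "U \<noteq> {}" "U \<subseteq> {a..b}" and V: "V \<subseteq> U" "V \<subseteq> {a<..<b}"
    and m: "m = card U + card V"
    and cont: "continuous_on {a..b} f"
    and D0: "\<And>x. a < x \<Longrightarrow> x < b \<Longrightarrow> D 0 x = f x"
    and deriv: "\<And>j x. j < m \<Longrightarrow> a < x \<Longrightarrow> x < b \<Longrightarrow> (D j has_real_derivative D (Suc j) x) (at x)"
    and nonneg: "\<And>x. a < x \<Longrightarrow> x < b \<Longrightarrow> D m x \<ge> 0"
    and p: "\<And>i. i \<ge> m \<Longrightarrow> coeff p i = 0" "\<And>u. u \<in> U \<Longrightarrow> poly p u = f u"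
      "\<And>v. v \<in> V \<Longrightarrow> poly (pderiv p) v = D 1 v"
    and x: "a < x" "x < b"
  shows "\<exists>K\<ge>0. f x - poly p x = K * ((\<Prod>u\<in>U. x - u) * (\<Prod>v\<in>V. x - v))"
proof (cases "x \<in> U")
  case True
  then show ?thesis using p(2)[OF True] U(1) by (intro exI[of _ 0]) auto
next
  case False
  have finV: "finite V" using U V by (auto intro: finite_subset)
  define W where "W = (\<Prod>u\<in>U. [:- u, 1:]) * (\<Prod>v\<in>V. [:- v, 1:])"
  have Wx: "poly W t = (\<Prod>u\<in>U. t - u) * (\<Prod>v\<in>V. t - v)" for t by (simp add: W_def poly_prod)
  have W0: "poly W x \<noteq> 0" using False V U finV by (auto simp: Wx)
  have degW: "degree W = m" unfolding W_def m using U finV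
    by (subst degree_mult_eq) (auto simp: degree_prod_eq_sum_degree)
  have lcW: "coeff W m = 1"
    unfolding degW[symmetric] by (simp add: W_def lead_coeff_mult lead_coeff_prod)
  define K where "K = (f x - poly p x) / poly W x"
  define q where "q = p + smult K W"
  have q: "coeff q m = K" "\<And>i. i > m \<Longrightarrow> coeff q i = 0"
    using p(1) lcW degW by (auto simp: q_def coeff_eq_0)
  define E where "E j t = D j t - poly ((pderiv ^^ j) q) t" for j t
  have E: "(E j has_real_derivative E (Suc j) t) (at t)" if "j < m" "a < t" "t < b" for j t
    unfolding E_def using deriv[OF that] by (auto intro!: derivative_eq_intros)
  have WU: "poly W u = 0" if "u \<in> U" for u using that U by (auto simp: Wx)
  have "continuous_on {a..b} (\<lambda>t. f t - poly q t)" by (intro continuous_intros cont)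
  moreover have "((\<lambda>t. f t - poly q t) has_real_derivative E 1 t) (at t)" if "a < t" "t < b" for t
  proof -
    have "m > 0" using U by (auto simp: m card_gt_0_iff)
    have "(E 0 has_real_derivative E 1 t) (at t)" using E[of 0 t] \<open>m > 0\<close> that by simp
    then show ?thesis
      by (rule has_field_derivative_transform_within_open[where S = "{a<..<b}"])
         (use that D0 in \<open>auto simp: E_def\<close>)
  qed
  moreover have "f t - poly q t = 0" if "t \<in> insert x U" for t
    using that WU p(2) W0 by (auto simp: q_def K_def)
  ultimately obtain B where B: "finite B" "B \<subseteq> {a<..<b}" "B \<inter> insert x U = {}"
      "Suc (card B) = card (insert x U)" "\<forall>t\<in>B. E 1 t = 0"
    using rolle_zeros[of "{a..b}" a b "\<lambda>t. f t - poly q t" "E 1" "insert x U"] U x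
    by (auto simp: is_interval_cc)
  have "poly (pderiv W) v = 0" if "v \<in> V" for v
  proof -
    have "poly (\<Prod>u\<in>U. [:- u, 1:]) v = 0" "poly (\<Prod>v\<in>V. [:- v, 1:]) v = 0"
      using that V U finV by (auto simp: poly_prod)
    then show ?thesis by (simp add: W_def pderiv_mult)
  qed
  then have E1V: "E 1 v = 0" if "v \<in> V" for v
    using that p(3) by (simp add: E_def q_def pderiv_add pderiv_smult)
  have "\<exists>\<xi>. a < \<xi> \<and> \<xi> < b \<and> E (Suc (m - 1)) \<xi> = 0"
  proof (rule iterated_rolle[where D = "\<lambda>j. E (Suc j)" and A = "B \<union> V"])
    have "card (B \<union> V) = card B + card V"
      using B V finV by (intro card_Un_disjoint) auto
    moreover have "card U > 0" using U by (simp add: card_gt_0_iff)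
    ultimately show "card (B \<union> V) > m - 1" using B(4) False U by (simp add: m)
  qed (use B E1V V finV E in auto)
  moreover have "m > 0" using U by (auto simp: m card_gt_0_iff)
  ultimately obtain \<xi> where \<xi>: "a < \<xi>" "\<xi> < b" "E m \<xi> = 0" by auto
  have "D m \<xi> = fact m * K"
    using \<xi>(3) pderiv_funpow_degree[of m q] q by (simp add: E_def)
  with nonneg[OF \<xi>(1,2)] have "0 \<le> fact m * K" by simp
  moreover have "(0::real) < fact m" by simp
  ultimately have "K \<ge> 0" by (meson mult_pos_neg not_le)
  moreover have "f x - poly p x = K * poly W x" using W0 by (simp add: K_def)
  ultimately show ?thesis by (intro exI[of _ K] conjI) (simp_all only: Wx)
qed

text \<open>
  All nodes except \<open>1\<close> and possibly \<open>0\<close> are double, so the nodal polynomial is nonpositive on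
  \<open>[0, 1]\<close>.
\<close>

lemma hermite_majorant:
  fixes f :: "real \<Rightarrow> real" and D :: "nat \<Rightarrow> real \<Rightarrow> real"
  assumes U: "finite U" "U \<subseteq> {0..<1}" and m: "m = Suc (card U + card (U - {0}))"
    and cont: "continuous_on {0..1} f"
    and D0: "\<And>x. 0 < x \<Longrightarrow> x < 1 \<Longrightarrow> D 0 x = f x"
    and deriv: "\<And>j x. j < m \<Longrightarrow> 0 < x \<Longrightarrow> x < 1 \<Longrightarrow> (D j has_real_derivative D (Suc j) x) (at x)"
    and nonneg: "\<And>x. 0 < x \<Longrightarrow> x < 1 \<Longrightarrow> D m x \<ge> 0"
  obtains p where "degree p < m" "\<And>u. u \<in> insert 1 U \<Longrightarrow> poly p u = f u"
    "\<And>x. 0 \<le> x \<Longrightarrow> x \<le> 1 \<Longrightarrow> f x \<le> poly p x"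
proof -
  have "1 \<notin> U" using U by auto
  then have card: "card (insert 1 U) + card (U - {0}) = m" using U unfolding m by simp
  have "finite (insert 1 U)" "U - {0} \<subseteq> insert 1 U" using U by auto
  from ex_hermite_interpolant[OF this, of f "D 1"]
  have "\<exists>p. (\<forall>i\<ge>m. coeff p i = 0) \<and> (\<forall>u\<in>insert 1 U. poly p u = f u) \<and>
      (\<forall>v\<in>U - {0}. poly (pderiv p) v = D 1 v)"
    by (simp only: card)
  then obtain p where p_all: "\<forall>i\<ge>m. coeff p i = 0" "\<forall>u\<in>insert 1 U. poly p u = f u"
    "\<forall>v\<in>U - {0}. poly (pderiv p) v = D 1 v"
    by (elim exE conjE)
  note p = p_all[rule_format]
  have inner: "f x \<le> poly p x" if x: "0 < x" "x < 1" for x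
  proof -
    have "finite (insert 1 U)" "insert 1 U \<noteq> {}" "insert 1 U \<subseteq> {0..1}"
      "U - {0} \<subseteq> insert 1 U" "U - {0} \<subseteq> {0<..<1}"
      using U by (auto simp: order_less_le)
    from hermite_error[where f = f and D = D and p = p, OF this card[symmetric] cont D0 deriv nonneg p x]
    obtain K where K: "K \<ge> 0"
      "f x - poly p x = K * ((\<Prod>u\<in>insert 1 U. x - u) * (\<Prod>v\<in>U - {0}. x - v))"
      by blast
    define R where "R = (\<Prod>v\<in>U - {0}. x - v)"
    define c where "c = (if 0 \<in> U then x else 1)"
    have e1: "(\<Prod>u\<in>insert 1 U. x - u) = (x - 1) * (\<Prod>u\<in>U. x - u)"
      using U by (subst prod.insert) auto
    have e2: "(\<Prod>u\<in>U. x - u) = c * R"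
      using U by (auto simp: R_def c_def prod.remove[of U 0])
    have "(\<Prod>u\<in>insert 1 U. x - u) * R = - ((1 - x) * c * (R * R))"
      unfolding e1 e2 by (simp add: algebra_simps)
    moreover have "(1 - x) * c * (R * R) \<ge> 0"
      using x by (intro mult_nonneg_nonneg[OF _ zero_le_square] mult_nonneg_nonneg) (auto simp: c_def)
    ultimately have "(\<Prod>u\<in>insert 1 U. x - u) * R \<le> 0" by linarith
    then have "f x - poly p x \<le> 0" using K by (simp add: R_def mult_nonneg_nonpos)
    then show ?thesis by simp
  qed
  have "degree p < m"
  proof (cases "p = 0")
    case False
    then show ?thesis using p(1)[of "degree p"] by (intro not_le_imp_less notI) simp
  qed (simp add: m)
  moreover have "f x \<le> poly p x" if x: "0 \<le> x" "x \<le> 1" for x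
  proof -
    \<comment> \<open>The endpoint \<open>0\<close> need not be a node; there the inequality follows by continuity.\<close>
    have "continuous_on (closure {0<..<1}) (\<lambda>x. f x - poly p x)"
      by (simp, intro continuous_intros cont)
    moreover have "x \<in> closure {0<..<1}" using x by simp
    moreover have "f y - poly p y \<le> 0" if "y \<in> {0<..<1}" for y using inner[of y] that by simp
    ultimately have "f x - poly p x \<le> 0" by (rule continuous_le_on_closure)
    then show ?thesis by simp
  qed
  ultimately show thesis using p(2) by (intro that[of p])
qed

section \<open>Averages over designs and the bound on the potential\<close>

lemma poly_eq_sum_coeff:
  fixes p :: "real poly"
  assumes "degree p \<le> d"
  shows "poly p t = (\<Sum>i\<le>d. coeff p i * t ^ i)"
proof -
  have "poly p t = poly (\<Sum>i\<le>d. monom (coeff p i) i) t"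
    using poly_as_sum_of_monoms'[OF assms] by simp
  then show ?thesis by (simp add: poly_sum poly_monom)
qed

lemma gegenbauer_odd_coeff:
  assumes "n \<ge> 2" "even l" "odd i"
  shows "coeff (gegenbauer n l) i = 0"
proof -
  interpret even_positive_functional "gegenbauer_functional n"
    by (rule even_positive_functional_gegenbauer[OF assms(1)])
  have "coeff (pcompose (gegenbauer n l) [:0, -1:]) i = coeff (gegenbauer n l) i"
    using orthogonal_parity[OF gegenbauer_orthogonal[OF assms(1)], of l] assms(2) by simp
  moreover have "coeff (pcompose (gegenbauer n l) [:0, -1:]) i = (-1) ^ i * coeff (gegenbauer n l) i"
    using coeff_pcompose_linear[of "gegenbauer n l" "-1" i] by simp
  ultimately show ?thesis using assms(3) by simp
qed

text \<open>
  The design condition transfers from the Gegenbauer polynomials of even degree to the even monomials: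
  \<open>F i\<close> is the deviation of the double sum of \<open>t\<^sup>i\<close> from its expected value, and the design
  condition says that the coefficients of the polynomial of degree \<open>2 m\<close> annihilate \<open>F\<close>. By parity
  only even exponents occur, by induction only the leading one survives.
\<close>

lemma design_energy:
  fixes C :: "(real^'n) set"
  assumes n: "CARD('n) \<ge> 2" and C: "spherical_kk_design k C" and m: "m \<le> k"
  shows "(\<Sum>x\<in>C. \<Sum>y\<in>C. (x \<bullet> y) ^ (2 * m)) =
    (real (card C))\<^sup>2 * gegenbauer_functional CARD('n) (monom 1 (2 * m))"
  using m
proof (induction m rule: less_induct)
  case (less m)
  interpret even_positive_functional "gegenbauer_functional CARD('n)"
    by (rule even_positive_functional_gegenbauer[OF n])
  define J where "J = gegenbauer_functional CARD('n)"
  define F where "F i = (\<Sum>x\<in>C. \<Sum>y\<in>C. (x \<bullet> y) ^ i) - (real (card C))\<^sup>2 * J (monom 1 i)" for i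
  have IH: "F (2 * j) = 0" if "j < m" for j
    using less.IH[OF that] less.prems that by (simp add: F_def J_def)
  have "F (2 * m) = 0"
  proof (cases "m = 0")
    case True
    have "J (monom 1 0) = 1"
      using gegenbauer_functional_1[OF n] by (simp add: J_def monom_0 one_pCons)
    then show ?thesis by (simp add: True F_def power2_eq_square)
  next
    case False
    define P where "P = gegenbauer CARD('n) (2 * m)"
    have P: "degree P = 2 * m" "P \<noteq> 0" "\<And>r. \<forall>i\<ge>2 * m. coeff r i = 0 \<Longrightarrow> J (P * r) = 0"
      using gegenbauer_orthogonal[OF n, of "2 * m"]
      by (auto simp: P_def J_def is_orthogonal_of_degree_def)
    have "J P = 0" using P(3)[of 1] False by (simp add: coeff_eq_0)
    have zero: "(\<Sum>x\<in>C. \<Sum>y\<in>C. poly P (x \<bullet> y)) = 0"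
      using C less.prems False by (auto simp: spherical_kk_design_def P_def)
    have "(\<Sum>x\<in>C. \<Sum>y\<in>C. poly P (x \<bullet> y)) = (\<Sum>i\<le>2 * m. coeff P i * (\<Sum>x\<in>C. \<Sum>y\<in>C. (x \<bullet> y) ^ i))"
    proof -
      have "(\<Sum>x\<in>C. \<Sum>y\<in>C. poly P (x \<bullet> y)) = (\<Sum>x\<in>C. \<Sum>i\<le>2 * m. \<Sum>y\<in>C. coeff P i * (x \<bullet> y) ^ i)"
        using P(1) by (intro sum.cong refl) (subst sum.swap, simp add: poly_eq_sum_coeff[of P "2 * m"])
      also have "\<dots> = (\<Sum>i\<le>2 * m. \<Sum>x\<in>C. \<Sum>y\<in>C. coeff P i * (x \<bullet> y) ^ i)" by (rule sum.swap)
      finally show ?thesis by (simp add: sum_distrib_left)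
    qed
    moreover have "J P = (\<Sum>i\<le>2 * m. coeff P i * J (monom 1 i))"
    proof -
      have "P = (\<Sum>i\<le>2 * m. smult (coeff P i) (monom 1 i))"
        using poly_as_sum_of_monoms'[of P "2 * m"] P(1) by (simp add: smult_monom)
      then have "J P = J (\<Sum>i\<le>2 * m. smult (coeff P i) (monom 1 i))" by simp
      then show ?thesis unfolding J_def sum smult .
    qed
    ultimately have "(\<Sum>i\<le>2 * m. coeff P i * F i) = 0"
      using \<open>J P = 0\<close> zero
      by (simp add: F_def right_diff_distrib sum_subtractf mult.left_commute[of _ "(real (card C))\<^sup>2"]
          flip: sum_distrib_left)
    also have "(\<Sum>i\<le>2 * m. coeff P i * F i) = (\<Sum>j\<le>m. coeff P (2 * j) * F (2 * j))"
      by (rule sum_even_terms) (simp add: P_def gegenbauer_odd_coeff[OF n])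
    also have "\<dots> = (\<Sum>j\<le>m. if j = m then coeff P (2 * m) * F (2 * m) else 0)"
      using IH by (intro sum.cong) auto
    finally have "coeff P (2 * m) * F (2 * m) = 0" by simp
    then show ?thesis using P by (metis leading_coeff_0_iff mult_eq_0_iff)
  qed
  then show ?case by (simp add: F_def J_def)
qed

text \<open>
  The polynomial \<open>q t\<close> is \<open>p (t\<^sup>2)\<close>; being a combination of even powers up to \<open>2 k\<close>, it inherits the
  pointwise identity from the moments.
\<close>

lemma design_average:
  fixes C :: "(real^'n) set" and p :: "real poly"
  assumes n: "CARD('n) \<ge> 2" and C: "spherical_kk_design k C" and p: "degree p \<le> k"
    and q: "q = (\<Sum>i\<le>k. monom (coeff p i) (2 * i))" and x: "norm x = 1"
  shows "(\<Sum>y\<in>C. poly p ((x \<bullet> y)\<^sup>2)) = real (card C) * gegenbauer_functional CARD('n) q"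
proof -
  interpret even_positive_functional "gegenbauer_functional CARD('n)"
    by (rule even_positive_functional_gegenbauer[OF n])
  have code: "finite C" "C \<subseteq> sphere 0 1"
    using C by (auto simp: spherical_kk_design_def spherical_code_def)
  have "q = (\<Sum>i\<le>k. smult (coeff p i) (monom 1 (2 * i)))" by (simp add: q smult_monom)
  then have Jq: "gegenbauer_functional CARD('n) q
      = (\<Sum>i\<le>k. coeff p i * gegenbauer_functional CARD('n) (monom 1 (2 * i)))"
    by (simp only: sum smult)
  have pt: "(\<Sum>y\<in>C. (x \<bullet> y) ^ (2 * i)) = real (card C) * gegenbauer_functional CARD('n) (monom 1 (2 * i))"
    if "i \<le> k" for i
    using unit_vectors_moment_pointwise[OF code x, of i] design_energy[OF n C that]
    by (simp only: gegenbauer_moment[OF n])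
  have "(\<Sum>y\<in>C. poly p ((x \<bullet> y)\<^sup>2)) = (\<Sum>y\<in>C. \<Sum>i\<le>k. coeff p i * (x \<bullet> y) ^ (2 * i))"
    by (simp add: poly_eq_sum_coeff[OF p] power_mult)
  also have "\<dots> = (\<Sum>i\<le>k. coeff p i * (\<Sum>y\<in>C. (x \<bullet> y) ^ (2 * i)))"
    by (subst sum.swap) (simp add: sum_distrib_left)
  also have "\<dots> = (\<Sum>i\<le>k. coeff p i * (real (card C) * gegenbauer_functional CARD('n) (monom 1 (2 * i))))"
    by (intro sum.cong refl) (simp add: pt)
  also have "\<dots> = real (card C) * gegenbauer_functional CARD('n) q"
    by (simp add: Jq sum_distrib_left mult.left_commute)
  finally show ?thesis .
qed

text \<open>
  This counts the interpolation conditions: each pair \<open>\<plusminus>t\<close> of nonzero elements gives one square, which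
  is counted twice on the left, while \<open>0\<close> is counted once on both sides.
\<close>

lemma card_squares_symmetric:
  fixes Z :: "real set"
  assumes Z: "finite Z" "\<And>t. t \<in> Z \<Longrightarrow> - t \<in> Z"
  defines "U \<equiv> (\<lambda>t. t\<^sup>2) ` Z"
  shows "card U + card (U - {0}) = card Z"
proof -
  define Zp where "Zp = Z \<inter> {0<..}"
  have fin: "finite Zp" using Z by (simp add: Zp_def)
  have "U - {0} = (\<lambda>t. t\<^sup>2) ` Zp"
  proof
    show "U - {0} \<subseteq> (\<lambda>t. t\<^sup>2) ` Zp"
    proof
      fix u assume "u \<in> U - {0}"
      then obtain t where t: "t \<in> Z" "u = t\<^sup>2" "t \<noteq> 0" by (auto simp: U_def)
      then have "\<bar>t\<bar> \<in> Zp" using Z(2)[of t] by (auto simp: Zp_def abs_if)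
      then show "u \<in> (\<lambda>t. t\<^sup>2) ` Zp" using t by (intro image_eqI[of _ _ "\<bar>t\<bar>"]) auto
    qed
  qed (auto simp: U_def Zp_def)
  moreover have "inj_on (\<lambda>t. t\<^sup>2) Zp" by (auto simp: inj_on_def Zp_def power2_eq_iff)
  ultimately have Up: "card (U - {0}) = card Zp" by (simp add: card_image)
  have "U = (U - {0}) \<union> (Z \<inter> {0})" by (auto simp: U_def)
  then have "card U = card ((U - {0}) \<union> (Z \<inter> {0}))" by simp
  also have "\<dots> = card Zp + card (Z \<inter> {0})"
    using Z Up by (subst card_Un_disjoint) (auto simp: U_def)
  finally have "card U = card Zp + card (Z \<inter> {0})" .
  moreover have "card Z = card Zp + card (uminus ` Zp) + card (Z \<inter> {0})"
  proof -
    have "Z = (Zp \<union> uminus ` Zp) \<union> (Z \<inter> {0})"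
    proof
      show "Z \<subseteq> (Zp \<union> uminus ` Zp) \<union> (Z \<inter> {0})"
      proof
        fix t assume t: "t \<in> Z"
        consider "t > 0" | "t = 0" | "t < 0" by linarith
        then show "t \<in> (Zp \<union> uminus ` Zp) \<union> (Z \<inter> {0})"
        proof cases
          case 3
          then have "- t \<in> Zp" using Z(2)[OF t] by (simp add: Zp_def)
          then have "- (- t) \<in> uminus ` Zp" by (rule imageI)
          then show ?thesis by simp
        qed (use t in \<open>auto simp: Zp_def\<close>)
      qed
    qed (use Z in \<open>auto simp: Zp_def\<close>)
    then have "card Z = card ((Zp \<union> uminus ` Zp) \<union> (Z \<inter> {0}))" by simp
    also have "\<dots> = card (Zp \<union> uminus ` Zp) + card (Z \<inter> {0})"
      using fin Z by (intro card_Un_disjoint) (auto simp: Zp_def)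
    also have "card (Zp \<union> uminus ` Zp) = card Zp + card (uminus ` Zp)"
      using fin by (intro card_Un_disjoint) (auto simp: Zp_def)
    finally show ?thesis .
  qed
  moreover have "card (uminus ` Zp) = card Zp" by (intro card_image) (auto simp: inj_on_def)
  ultimately show ?thesis using Up by simp
qed

lemma continuous_on_real_of_ereal_Icc:
  fixes g :: "real \<Rightarrow> ereal"
  assumes cont: "continuous_on {0..<1} g" and lim: "(g \<longlongrightarrow> g 1) (at_left 1)"
    and fin: "\<And>u. u \<in> {0..1} \<Longrightarrow> \<bar>g u\<bar> \<noteq> \<infinity>"
  shows "continuous_on {0..1} (\<lambda>u. real_of_ereal (g u))"
  unfolding continuous_on_def
proof
  fix u :: real assume u: "u \<in> {0..1}"
  have "(g \<longlongrightarrow> g u) (at u within {0..1})"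
  proof (cases "u = 1")
    case True
    then show ?thesis using lim by (simp add: at_within_Icc_at_left)
  next
    case False
    then have "u \<in> {..<1}" using u by simp
    then have "at u within {0..1} = at u within {0..<1}"
      by (intro at_within_nhd[of u "{..<1}"]) auto
    then show ?thesis using cont u False by (auto simp: continuous_on_def)
  qed
  then have "(g \<longlongrightarrow> ereal (real_of_ereal (g u))) (at u within {0..1})"
    using fin[OF u] by (simp add: ereal_real)
  then show "((\<lambda>u. real_of_ereal (g u)) \<longlongrightarrow> real_of_ereal (g u)) (at u within {0..1})"
    by (rule lim_real_of_ereal)
qed

theorem theorem4p3:
  fixes k N :: nat
    and g h :: "real \<Rightarrow> ereal"
    and C :: "(real^'n) set"
  assumes "CARD('n) \<ge> 2" and "k \<ge> 1" and "N \<ge> 1"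
    and "\<forall>t\<in>{-1..1}. h t = g (t\<^sup>2)"
    and "\<forall>u\<in>{0..1}. g u \<noteq> -\<infinity>"
    and "\<forall>u\<in>{0..<1}. \<bar>g u\<bar> \<noteq> \<infinity>"
    and "continuous_on {0..<1} g"
    and "(g \<longlongrightarrow> g 1) (at_left 1)"
    and "times_differentiable_on (k + 1) (\<lambda>u. real_of_ereal (g u)) {0<..<1}"
    and "spherical_kk_design k C" and "card C = N"
    and "\<forall>u\<in>{0<..<1}. (deriv ^^ (k + 1)) (\<lambda>u. real_of_ereal (g u)) u \<ge> 0"
    and "\<bar>g 1\<bar> \<noteq> \<infinity>"
  shows "minmax_potential TYPE('n) h N \<le> minmax_potential_design TYPE('n) h N k
    \<and> minmax_potential_design TYPE('n) h N k \<le> max_potential h C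
    \<and> max_potential h C \<le>
        ereal (real N) *
          (\<Sum>i=0..k+1. ereal (gegenbauer_weight CARD('n) k i) * h (gegenbauer_node CARD('n) k i))"
proof (intro conjI)
  show "minmax_potential TYPE('n) h N \<le> minmax_potential_design TYPE('n) h N k"
    unfolding minmax_potential_def minmax_potential_design_def
    by (intro INF_superset_mono) (auto simp: spherical_kk_design_def)
  show "minmax_potential_design TYPE('n) h N k \<le> max_potential h C"
    unfolding minmax_potential_design_def using assms(10,11) by (intro INF_lower) simp
next
  define f where "f u = real_of_ereal (g u)" for u
  define Z where "Z = {t. poly (gegenbauer (CARD('n) + 2) k) t = 0}"
  define U where "U = (\<lambda>t. t\<^sup>2) ` Z"
  let ?\<beta> = "gegenbauer_node CARD('n) k" and ?\<delta> = "gegenbauer_weight CARD('n) k"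
  have Z: "finite Z" "card Z = k" "Z \<subseteq> {-1<..<1}" "\<And>t. t \<in> Z \<Longrightarrow> - t \<in> Z"
    using gegenbauer_zeros[where n = "CARD('n) + 2" and k = k] by (auto simp: Z_def)
  have fin: "\<bar>g u\<bar> \<noteq> \<infinity>" if "u \<in> {0..1}" for u
    using that assms(6,13) by (cases "u = 1") auto
  have h: "h t = ereal (f (t\<^sup>2))" if t: "t \<in> {-1..1}" for t
  proof -
    have "t\<^sup>2 \<in> {0..1}" using t by (simp add: abs_square_le_1 abs_le_iff)
    then show ?thesis using fin[of "t\<^sup>2"] assms(4) t by (simp add: f_def ereal_real)
  qed
  have U: "finite U" "U \<subseteq> {0..<1}"
    using Z(1,3) one_minus_square_pos by (auto simp: U_def)
  have card_U: "k + 1 = Suc (card U + card (U - {0}))"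
    using card_squares_symmetric[OF Z(1,4)] Z(2) by (simp add: U_def)
  have cont: "continuous_on {0..1} f"
    unfolding f_def using assms(7,8) fin by (rule continuous_on_real_of_ereal_Icc)
  have D0: "(deriv ^^ 0) f u = f u" if "0 < u" "u < 1" for u by simp
  have deriv: "((deriv ^^ j) f has_real_derivative (deriv ^^ Suc j) f u) (at u)"
    if "j < k + 1" "0 < u" "u < 1" for j u
    using assms(9) that
    by (auto simp: times_differentiable_on_def f_def[abs_def] DERIV_deriv_iff_real_differentiable)
  have nonneg: "(deriv ^^ (k + 1)) f u \<ge> 0" if "0 < u" "u < 1" for u
    using assms(12) that by (simp add: f_def[abs_def])
  obtain p where p: "degree p < k + 1" "\<And>u. u \<in> insert 1 U \<Longrightarrow> poly p u = f u"
    "\<And>u. 0 \<le> u \<Longrightarrow> u \<le> 1 \<Longrightarrow> f u \<le> poly p u"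
  proof (rule hermite_majorant[where D = "\<lambda>j. (deriv ^^ j) f", OF U card_U cont D0 deriv nonneg])
    fix p assume "degree p < k + 1" "\<And>u. u \<in> insert 1 U \<Longrightarrow> poly p u = f u"
      "\<And>u. 0 \<le> u \<Longrightarrow> u \<le> 1 \<Longrightarrow> f u \<le> poly p u"
    then show thesis by (rule that)
  qed
  define q where "q = (\<Sum>i\<le>k. monom (coeff p i) (2 * i))"
  have qp: "poly q t = poly p (t\<^sup>2)" for t
    using poly_eq_sum_coeff[of p k "t\<^sup>2"] p(1) by (simp add: q_def poly_sum poly_monom power_mult)
  have "degree q \<le> 2 * k"
    unfolding q_def by (intro degree_sum_le) (auto intro: order_trans[OF degree_monom_le])
  then have "gegenbauer_functional CARD('n) q = (\<Sum>i=0..k+1. ?\<delta> i * poly q (?\<beta> i))"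
    by (intro gegenbauer_lobatto_quadrature assms(1)) simp
  also have "\<dots> = (\<Sum>i=0..k+1. ?\<delta> i * f ((?\<beta> i)\<^sup>2))"
  proof (intro sum.cong refl)
    fix i assume "i \<in> {0..k+1}"
    then have "?\<beta> i \<in> insert (-1) (insert 1 Z)"
      using gegenbauer_node_bij[of "CARD('n)" k] unfolding Z_def bij_betw_def by blast
    then have "(?\<beta> i)\<^sup>2 \<in> insert 1 U" by (auto simp: U_def)
    then show "?\<delta> i * poly q (?\<beta> i) = ?\<delta> i * f ((?\<beta> i)\<^sup>2)" using p(2) qp by simp
  qed
  finally have quad: "gegenbauer_functional CARD('n) q = (\<Sum>i=0..k+1. ?\<delta> i * f ((?\<beta> i)\<^sup>2))" .
  have rhs: "(\<Sum>i=0..k+1. ereal (?\<delta> i) * h (?\<beta> i)) = ereal (gegenbauer_functional CARD('n) q)"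
    unfolding quad sum_ereal[symmetric]
  proof (intro sum.cong refl)
    fix i assume "i \<in> {0..k+1}"
    then have "?\<beta> i \<in> insert (-1) (insert 1 Z)"
      using gegenbauer_node_bij[of "CARD('n)" k] unfolding Z_def bij_betw_def by blast
    then have "?\<beta> i \<in> {-1..1}" using Z(3) by auto
    then show "ereal (?\<delta> i) * h (?\<beta> i) = ereal (?\<delta> i * f ((?\<beta> i)\<^sup>2))" by (simp add: h)
  qed
  show "max_potential h C \<le> ereal (real N) * (\<Sum>i=0..k+1. ereal (?\<delta> i) * h (?\<beta> i))"
    unfolding max_potential_def rhs
  proof (rule SUP_least)
    fix x :: "real^'n" assume "x \<in> sphere 0 1"
    then have x: "norm x = 1" by simp
    have ip: "x \<bullet> y \<in> {-1..1}" if "y \<in> C" for y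
    proof -
      have "norm y = 1"
        using that assms(10) by (auto simp: spherical_kk_design_def spherical_code_def)
      then have "\<bar>x \<bullet> y\<bar> \<le> 1" using Cauchy_Schwarz_ineq2[of x y] x by simp
      then show ?thesis by (simp add: abs_le_iff)
    qed
    have "potential h C x = ereal (\<Sum>y\<in>C. f ((x \<bullet> y)\<^sup>2))"
      unfolding potential_def sum_ereal[symmetric] by (intro sum.cong refl h ip)
    also have "\<dots> \<le> ereal (\<Sum>y\<in>C. poly p ((x \<bullet> y)\<^sup>2))"
      unfolding ereal_less_eq(3)
    proof (rule sum_mono)
      fix y assume "y \<in> C"
      from ip[OF this] show "f ((x \<bullet> y)\<^sup>2) \<le> poly p ((x \<bullet> y)\<^sup>2)"
        by (intro p(3)) (simp_all add: abs_square_le_1 abs_le_iff)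
    qed
    also have "(\<Sum>y\<in>C. poly p ((x \<bullet> y)\<^sup>2)) = real N * gegenbauer_functional CARD('n) q"
      using design_average[OF assms(1,10) _ q_def x] p(1) assms(11) by simp
    finally show "potential h C x \<le> ereal (real N) * ereal (gegenbauer_functional CARD('n) q)" by simp
  qed
qed

end
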